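(* Let $d>1$, let $f_1,\dots,f_d:\mathbb Z\to\mathbb C^*$ be additive characters with $\prod_{k=i}^d|f_k(1)|\le1$ for all $1\le i\le d$, let $n\in\mathbb Z$, let $k_d'$ be a non-negative integer, and let $$b_d:=-2k_d'+\frac{\log f_d(1)}{\log\alpha}+k_d'\frac{\log|Q|}{\log\alpha}+\left(2n+\ell_{Q,k_d'}\right)\frac{\pi i}{\log\alpha}.$$ Then $$\underset{s_d=b_d}{\mathrm{Res}}\ \mathcal L_U^d(\mathbf s\mid\mathbf f)=\mathcal L_U^{d-1}(s_1,\dots,s_{d-1}\mid f_1,\dots,f_{d-1})\,D^{b_d/2}\binom{-b_d}{k_d'}(-1)^{k_d'}\frac{1}{\log\alpha}.$$
   Context: Standing assumptions: $P,Q$ are real numbers with $P>0$, $Q\ne 0$, $D:=P^2-4Q$, and $Q<P-1$ if $0<P\le 2$, $Q\le P-1$ if $P>2$. Let $\alpha,\beta$ be the roots of $x^2-Px+Q=0$, with $\alpha=(P+\sqrt D)/2$, $\beta=(P-\sqrt D)/2$, and let $U_n=(\alpha^n-\beta^n)/(\alpha-\beta)$ for $n\ge 0$ (Lucas sequence of the first kind). Complex powers of positive reals are taken with the real logarithm; $\log f_d(1)$ is a fixed value of the complex logarithm. An additive character is a group homomorphism $f:\mathbb Z\to\mathbb C^*$, so $f(n)=f(1)^n$. The multiple Lucas additive $L$-function of depth $e$ is the meromorphic continuation to $\mathbb C^e$ (from its region of absolute convergence) of $$\mathcal L_U^e(s_1,\dots,s_e\mid f_1,\dots,f_e):=\sum_{0<n_1<\cdots<n_e}\frac{f_1(n_1)}{U_{n_1}^{s_1}}\cdots\frac{f_e(n_e)}{U_{n_e}^{s_e}};$$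 $\mathcal L_U^d(\mathbf s\mid\mathbf f)$ abbreviates $\mathcal L_U^d(s_1,\dots,s_d\mid f_1,\dots,f_d)$. $\ell_{Q,k}:=0$ if $Q>0$ and $\ell_{Q,k}:=k$ if $Q<0$. The residue along the hyperplane $s_d=b_d$ is the restriction of the meromorphic function $(s_d-b_d)\,\mathcal L_U^d(\mathbf s\mid\mathbf f)$ to that hyperplane. *)

theory Defs
  imports "HOL-Complex_Analysis.Complex_Analysis"
begin

subsection \<open>Meromorphic functions on \<open>\<complex>\<^sup>e\<close>\<close>

text \<open>
  Points of \<open>\<complex>\<^sup>e\<close> are functions on the index set \<open>{1..e}\<close>, extended by \<open>undefined\<close>.
  The topology is the subspace topology of the product topology on \<^typ>\<open>nat \<Rightarrow> complex\<close>,
  which on this set is the usual one.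
\<close>

definition cspace :: "nat \<Rightarrow> (nat \<Rightarrow> complex) set" where
  "cspace e = {1..e} \<rightarrow>\<^sub>E UNIV"

definition polydisc :: "nat \<Rightarrow> (nat \<Rightarrow> complex) \<Rightarrow> real \<Rightarrow> (nat \<Rightarrow> complex) set" where
  "polydisc e p r = {z \<in> cspace e. \<forall>i\<in>{1..e}. dist (z i) (p i) < r}"

text \<open>
  Holomorphy in several variables on a (relatively) open subset \<open>A\<close> of \<open>\<complex>\<^sup>e\<close>: continuous, and
  holomorphic in each variable separately.
\<close>

definition mv_holomorphic_on ::
    "nat \<Rightarrow> ((nat \<Rightarrow> complex) \<Rightarrow> complex) \<Rightarrow> (nat \<Rightarrow> complex) set \<Rightarrow> bool" where
  "mv_holomorphic_on e g A \<longleftrightarrow>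
     continuous_on A g \<and>
     (\<forall>z\<in>A. \<forall>i\<in>{1..e}. (\<lambda>w. g (z(i := w))) holomorphic_on {w. z(i := w) \<in> A})"

text \<open>
  A meromorphic function is represented by a total function whose values on a nowhere dense
  closed set are irrelevant. Two representatives of the same meromorphic function on an open
  set \<open>A\<close> agree on a dense open subset of \<open>A\<close>.
\<close>

definition generically_eq_on ::
    "nat \<Rightarrow> (nat \<Rightarrow> complex) set \<Rightarrow> ((nat \<Rightarrow> complex) \<Rightarrow> complex) \<Rightarrow>
     ((nat \<Rightarrow> complex) \<Rightarrow> complex) \<Rightarrow> bool" where
  "generically_eq_on e A F G \<longleftrightarrow>
     (\<exists>W\<subseteq>A. openin (top_of_set (cspace e)) W \<and> A \<subseteq> closure W \<and> (\<forall>z\<in>W. F z = G z))"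

text \<open>Locally a quotient of holomorphic functions, the denominator not being identically zero.\<close>

definition mv_meromorphic :: "nat \<Rightarrow> ((nat \<Rightarrow> complex) \<Rightarrow> complex) \<Rightarrow> bool" where
  "mv_meromorphic e F \<longleftrightarrow>
     (\<forall>p\<in>cspace e. \<exists>r>0. \<exists>g h.
        mv_holomorphic_on e g (polydisc e p r) \<and>
        mv_holomorphic_on e h (polydisc e p r) \<and>
        (\<exists>z\<in>polydisc e p r. h z \<noteq> 0) \<and>
        generically_eq_on e (polydisc e p r) F (\<lambda>z. g z / h z))"

text \<open>
  \<open>restricts_to_hyperplane d G b R\<close>: the meromorphic function \<open>G\<close> on \<open>\<complex>\<^sup>d\<close> has a restriction to
  the hyperplane \<open>s\<^sub>d = b\<close> (its polar set does not contain the hyperplane), and this restriction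
  is the meromorphic function \<open>R\<close>. The hyperplane is identified with \<open>\<complex>\<^sup>d\<^sup>-\<^sup>1\<close> via
  \<open>s \<mapsto> s(d := b)\<close>. Locally \<open>G = g / h\<close> where \<open>h\<close> does not vanish identically on the
  hyperplane, and there \<open>R\<close> is the quotient of the restrictions of \<open>g\<close> and \<open>h\<close>. The values of the
  representative \<open>G\<close> on the hyperplane itself play no role.
\<close>

definition restricts_to_hyperplane ::
    "nat \<Rightarrow> ((nat \<Rightarrow> complex) \<Rightarrow> complex) \<Rightarrow> complex \<Rightarrow>
     ((nat \<Rightarrow> complex) \<Rightarrow> complex) \<Rightarrow> bool" where
  "restricts_to_hyperplane d G b R \<longleftrightarrow>
     (\<forall>p\<in>cspace (d - 1). \<exists>r>0. \<exists>g h.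
        mv_holomorphic_on d g (polydisc d (p(d := b)) r) \<and>
        mv_holomorphic_on d h (polydisc d (p(d := b)) r) \<and>
        (\<exists>s\<in>polydisc (d - 1) p r. h (s(d := b)) \<noteq> 0) \<and>
        generically_eq_on d (polydisc d (p(d := b)) r) G (\<lambda>z. g z / h z) \<and>
        generically_eq_on (d - 1) (polydisc (d - 1) p r) R
          (\<lambda>s. g (s(d := b)) / h (s(d := b))))"

definition has_residue_along ::
    "nat \<Rightarrow> ((nat \<Rightarrow> complex) \<Rightarrow> complex) \<Rightarrow> complex \<Rightarrow>
     ((nat \<Rightarrow> complex) \<Rightarrow> complex) \<Rightarrow> bool" where
  "has_residue_along d F b R \<longleftrightarrow> restricts_to_hyperplane d (\<lambda>s. (s d - b) * F s) b R"


subsection \<open>Lucas sequences and multiple Lucas additive \<open>L\<close>-functions\<close>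

definition lucas_disc :: "real \<Rightarrow> real \<Rightarrow> real" where
  "lucas_disc P Q = P\<^sup>2 - 4 * Q"

definition lucas_alpha :: "real \<Rightarrow> real \<Rightarrow> real" where
  "lucas_alpha P Q = (P + sqrt (lucas_disc P Q)) / 2"

definition lucas_beta :: "real \<Rightarrow> real \<Rightarrow> real" where
  "lucas_beta P Q = (P - sqrt (lucas_disc P Q)) / 2"

definition lucas_U :: "real \<Rightarrow> real \<Rightarrow> nat \<Rightarrow> real" where
  "lucas_U P Q n =
     (lucas_alpha P Q ^ n - lucas_beta P Q ^ n) / (lucas_alpha P Q - lucas_beta P Q)"

definition additive_character :: "(int \<Rightarrow> complex) \<Rightarrow> bool" where
  "additive_character f \<longleftrightarrow> (\<forall>m. f m \<noteq> 0) \<and> (\<forall>m n. f (m + n) = f m * f n)"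

definition increasing_tuples :: "nat \<Rightarrow> (nat \<Rightarrow> nat) set" where
  "increasing_tuples e =
     {n \<in> {1..e} \<rightarrow>\<^sub>E UNIV. (\<forall>i\<in>{1..e}. 0 < n i) \<and> strict_mono_on {1..e} n}"

definition lucas_L_term ::
    "real \<Rightarrow> real \<Rightarrow> nat \<Rightarrow> (nat \<Rightarrow> int \<Rightarrow> complex) \<Rightarrow> (nat \<Rightarrow> complex) \<Rightarrow>
     (nat \<Rightarrow> nat) \<Rightarrow> complex" where
  "lucas_L_term P Q e f s n =
     (\<Prod>i=1..e. f i (int (n i)) / (complex_of_real (lucas_U P Q (n i)) powr s i))"

definition lucas_L_region ::
    "real \<Rightarrow> real \<Rightarrow> nat \<Rightarrow> (nat \<Rightarrow> int \<Rightarrow> complex) \<Rightarrow> (nat \<Rightarrow> complex) set" where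
  "lucas_L_region P Q e f =
     {s \<in> cspace e. (\<lambda>n. norm (lucas_L_term P Q e f s n)) summable_on increasing_tuples e}"

definition lucas_L_continuation ::
    "real \<Rightarrow> real \<Rightarrow> nat \<Rightarrow> (nat \<Rightarrow> int \<Rightarrow> complex) \<Rightarrow> ((nat \<Rightarrow> complex) \<Rightarrow> complex) \<Rightarrow> bool" where
  "lucas_L_continuation P Q e f F \<longleftrightarrow>
     mv_meromorphic e F \<and>
     (\<forall>s\<in>lucas_L_region P Q e f. F s = (\<Sum>\<^sub>\<infinity>n\<in>increasing_tuples e. lucas_L_term P Q e f s n))"

text \<open>
  The meromorphic continuation is unique as a meromorphic function, so the choice only concerns
  the representative, to which \<^const>\<open>has_residue_along\<close> is insensitive.
\<close>

definition lucas_L ::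
    "real \<Rightarrow> real \<Rightarrow> nat \<Rightarrow> (nat \<Rightarrow> int \<Rightarrow> complex) \<Rightarrow> (nat \<Rightarrow> complex) \<Rightarrow> complex" where
  "lucas_L P Q e f = (SOME F. lucas_L_continuation P Q e f F)"

definition lucas_ell :: "real \<Rightarrow> nat \<Rightarrow> nat" where
  "lucas_ell Q k = (if Q > 0 then 0 else k)"

end

theory Submission
  imports Defs
begin

text \<open>
  With \<open>q = \<beta>/\<alpha>\<close>, \<open>0 < \<bar>q\<bar> < 1\<close>, one has \<open>U\<^sub>n = \<alpha>\<^sup>n (1 - q\<^sup>n) / \<surd>D\<close>. Expanding the powers of
  \<open>1 - q\<^sup>n\<close> by the binomial series and summing the resulting geometric series over
  \<open>0 < n\<^sub>1 < \<dots> < n\<^sub>e\<close> (substitute \<open>n\<^sub>i = m\<^sub>1 + \<dots> + m\<^sub>i\<close>) turns the L-series into a sum over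
  \<open>\<kappa> \<in> \<nat>\<^sup>e\<close> of products of binomial coefficients and of factors \<open>z\<^sub>i / (1 - z\<^sub>i)\<close>, where \<open>z\<^sub>i\<close> is the
  product over \<open>j \<ge> i\<close> of \<open>f\<^sub>j(1)\<close>, the \<open>-s\<^sub>j\<close>-th power of \<open>\<alpha>\<close> and the \<open>\<kappa>\<^sub>j\<close>-th power of \<open>q\<close>.
  Locally only finitely many of the possible denominators vanish, so after clearing them the
  Weierstrass M-test yields the meromorphic continuation. On \<open>s\<^sub>d = b\<close> exactly the summands with
  \<open>\<kappa>\<^sub>d = k\<close> have a pole in the last factor; there \<open>z\<^sub>d = 1\<close>, so the remaining factors are those of
  depth \<open>d - 1\<close>. Any other representative of the continuation agrees generically with this one by
  the identity theorem.
\<close>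

section \<open>Polydiscs as a neighbourhood basis of complex space\<close>

lemma polydisc_mono: "r \<le> r' \<Longrightarrow> polydisc e p r \<subseteq> polydisc e p r'"
  by (force simp: polydisc_def)

lemma polydisc_center: "p \<in> cspace e \<Longrightarrow> 0 < r \<Longrightarrow> p \<in> polydisc e p r"
  by (simp add: polydisc_def)

lemma polydisc_subset_cspace: "polydisc e p r \<subseteq> cspace e"
  by (auto simp: polydisc_def)

lemma polydisc_update:
  "z \<in> polydisc e p r \<Longrightarrow> i \<in> {1..e} \<Longrightarrow> z(i := w) \<in> polydisc e p r \<longleftrightarrow> dist w (p i) < r"
  by (auto simp: polydisc_def cspace_def PiE_iff extensional_def)

lemma openin_polydisc: "openin (top_of_set (cspace e)) (polydisc e p r)"
proof -
  have "open {z :: nat \<Rightarrow> complex. \<forall>i\<in>{1..e}. dist (z i) (p i) < r}"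
  proof -
    have "open (\<Inter>i\<in>{1..e}. {z :: nat \<Rightarrow> complex. dist (z i) (p i) < r})"
      by (intro open_INT finite_atLeastAtMost ballI open_Collect_less continuous_intros
          continuous_on_product_coordinates)
    moreover have "(\<Inter>i\<in>{1..e}. {z :: nat \<Rightarrow> complex. dist (z i) (p i) < r})
        = {z. \<forall>i\<in>{1..e}. dist (z i) (p i) < r}"
      by auto
    ultimately show ?thesis by simp
  qed
  then have "openin (top_of_set (cspace e)) (cspace e \<inter> {z. \<forall>i\<in>{1..e}. dist (z i) (p i) < r})"
    by (rule openin_open_Int)
  moreover have "polydisc e p r = cspace e \<inter> {z. \<forall>i\<in>{1..e}. dist (z i) (p i) < r}"
    by (auto simp: polydisc_def)
  ultimately show ?thesis by simp
qed

text \<open>A basic open set of the product topology prescribes a neighbourhood in every coordinate.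
  On \<open>cspace e\<close> the coordinates outside \<open>{1..e}\<close> are frozen at
  \<open>undefined\<close>, so finitely many radii decide and their minimum is positive.\<close>

lemma polydisc_base:
  assumes "openin (top_of_set (cspace e)) W" "z \<in> W"
  obtains \<epsilon> where "\<epsilon> > 0" "polydisc e z \<epsilon> \<subseteq> W"
proof -
  obtain U where U: "open U" "W = cspace e \<inter> U"
    using assms(1) by (auto simp: openin_open)
  then have "openin (product_topology (\<lambda>i. euclidean) UNIV) U"
    by (simp add: euclidean_product_topology)
  from product_topology_open_contains_basis[OF this, of z] assms(2) U
  obtain X where X: "\<And>i. z i \<in> X i" "\<And>i. open (X i)" "Pi\<^sub>E UNIV X \<subseteq> U"
    by (auto simp: PiE_iff)
  have "\<exists>\<epsilon>>0. ball (z i) \<epsilon> \<subseteq> X i" for i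
    using X(1,2) open_contains_ball by blast
  then obtain E where E: "\<And>i. E i > 0" "\<And>i. ball (z i) (E i) \<subseteq> X i"
    by metis
  \<comment> \<open>Inserting 1 keeps the set nonempty when \<open>e = 0\<close>.\<close>
  define \<epsilon> where "\<epsilon> = Min (insert 1 (E ` {1..e}))"
  have "\<epsilon> > 0"
    using E(1) by (auto simp: \<epsilon>_def)
  moreover have "polydisc e z \<epsilon> \<subseteq> W"
  proof
    fix y assume y: "y \<in> polydisc e z \<epsilon>"
    have zc: "z \<in> cspace e" using assms U by auto
    have "y i \<in> X i" for i
    proof (cases "i \<in> {1..e}")
      case True
      then have "dist (y i) (z i) < \<epsilon>" using y by (auto simp: polydisc_def)
      also have "\<epsilon> \<le> E i" using True by (auto simp: \<epsilon>_def intro!: Min_le min.coboundedI2)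
      finally show ?thesis using E(2)[of i] by (auto simp: dist_commute)
    next
      case False
      then have "y i = z i" using y zc
        by (auto simp: polydisc_def cspace_def PiE_iff extensional_def)
      then show ?thesis using X(1) by simp
    qed
    then show "y \<in> W" using X(3) y U by (auto simp: polydisc_def PiE_iff)
  qed
  ultimately show ?thesis using that by blast
qed

subsection \<open>Dense open sets and generic equality\<close>

lemma dense_meets_open:
  assumes "A \<subseteq> closure W" "openin (top_of_set (cspace e)) V" "V \<inter> A \<noteq> {}" "W \<subseteq> cspace e"
  shows "V \<inter> W \<noteq> {}"
proof -
  obtain U where U: "open U" "V = cspace e \<inter> U" using assms by (auto simp: openin_open)
  obtain x where "x \<in> U" "x \<in> closure W" using assms U by auto
  then have "U \<inter> W \<noteq> {}" using U(1) by (meson IntI disjoint_iff open_Int_closure_eq_empty)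
  then show ?thesis using U assms by auto
qed

lemma denseI:
  assumes "A \<subseteq> cspace e"
    and "\<And>V. openin (top_of_set (cspace e)) V \<Longrightarrow> V \<inter> A \<noteq> {} \<Longrightarrow> V \<inter> W \<noteq> {}"
  shows "A \<subseteq> closure W"
proof
  fix x assume x: "x \<in> A"
  show "x \<in> closure W"
  proof (rule ccontr)
    assume "x \<notin> closure W"
    then have "openin (top_of_set (cspace e)) (cspace e \<inter> - closure W)"
      by (intro openin_open_Int) auto
    with assms x \<open>x \<notin> closure W\<close> have "(cspace e \<inter> - closure W) \<inter> W \<noteq> {}"
      by blast
    then show False using closure_subset by fastforce
  qed
qed

text \<open>An open \<open>V\<close> meeting \<open>A\<close> meets \<open>W1\<close>; then
  \<open>V \<inter> W1\<close> is open and again meets \<open>A\<close>, so it meets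
  \<open>W2\<close>.\<close>

lemma dense_open_Int:
  assumes "openin (top_of_set (cspace e)) W1" "openin (top_of_set (cspace e)) W2"
    and "W1 \<subseteq> A" "W2 \<subseteq> A" "A \<subseteq> closure W1" "A \<subseteq> closure W2" "A \<subseteq> cspace e"
  shows "A \<subseteq> closure (W1 \<inter> W2)"
proof (rule denseI[of A e])
  fix V assume V: "openin (top_of_set (cspace e)) V" "V \<inter> A \<noteq> {}"
  have "V \<inter> W1 \<noteq> {}"
    using dense_meets_open[OF assms(5) V] assms by blast
  then have "(V \<inter> W1) \<inter> A \<noteq> {}" using assms(3) by blast
  then have "(V \<inter> W1) \<inter> W2 \<noteq> {}"
    using dense_meets_open[OF assms(6), of e "V \<inter> W1"] V assms by blast
  then show "V \<inter> (W1 \<inter> W2) \<noteq> {}" by blast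
qed (use assms in auto)

text \<open>Two generic identities hold simultaneously on one dense open set, so every pointwise
  consequence of them is generic too.\<close>

lemma generically_eq_on_combine:
  assumes "generically_eq_on e A F1 G1" "generically_eq_on e A F2 G2" "A \<subseteq> cspace e"
    and "\<And>z. z \<in> A \<Longrightarrow> F1 z = G1 z \<Longrightarrow> F2 z = G2 z \<Longrightarrow> F z = G z"
  shows "generically_eq_on e A F G"
proof -
  obtain W1 where W1: "W1 \<subseteq> A" "openin (top_of_set (cspace e)) W1" "A \<subseteq> closure W1" 
    "\<forall>z\<in>W1. F1 z = G1 z" using assms(1) unfolding generically_eq_on_def by blast
  obtain W2 where W2: "W2 \<subseteq> A" "openin (top_of_set (cspace e)) W2" "A \<subseteq> closure W2" 
    "\<forall>z\<in>W2. F2 z = G2 z" using assms(2) unfolding generically_eq_on_def by blast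
  show ?thesis unfolding generically_eq_on_def
  proof (intro exI conjI)
    show "A \<subseteq> closure (W1 \<inter> W2)" using dense_open_Int W1 W2 assms(3) by blast
  qed (use W1 W2 assms(4) in auto)
qed

lemma generically_eq_on_subset:
  assumes "generically_eq_on e A F G" "openin (top_of_set (cspace e)) B" "B \<subseteq> A" "A \<subseteq> cspace e"
  shows "generically_eq_on e B F G"
proof -
  obtain W1 where W1: "W1 \<subseteq> A" "openin (top_of_set (cspace e)) W1" "A \<subseteq> closure W1" 
    "\<forall>z\<in>W1. F z = G z" using assms(1) unfolding generically_eq_on_def by blast
  show ?thesis unfolding generically_eq_on_def
  proof (intro exI conjI)
    show "B \<subseteq> closure (W1 \<inter> B)"
    proof (rule denseI)
      show "B \<subseteq> cspace e" using assms by auto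
      fix V assume V: "openin (top_of_set (cspace e)) V" "V \<inter> B \<noteq> {}"
      then have "openin (top_of_set (cspace e)) (V \<inter> B)" using assms by blast
      moreover have "(V \<inter> B) \<inter> A \<noteq> {}" using V assms by blast
      ultimately have "(V \<inter> B) \<inter> W1 \<noteq> {}"
        using dense_meets_open[OF W1(3)] W1(1) assms by (meson order_trans)
      then show "V \<inter> (W1 \<inter> B) \<noteq> {}" by blast
    qed
  qed (use W1 assms in auto)
qed

subsection \<open>Holomorphic functions of several variables\<close>

lemma mv_holomorphic_on_subset:
  assumes "mv_holomorphic_on e g A" "B \<subseteq> A"
  shows "mv_holomorphic_on e g B"
  unfolding mv_holomorphic_on_def
proof (intro conjI ballI)
  show "continuous_on B g"
    using assms continuous_on_subset by (auto simp: mv_holomorphic_on_def)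
  fix z i assume z: "z \<in> B" "i \<in> {1..e}"
  then have "(\<lambda>w. g (z(i := w))) holomorphic_on {w. z(i := w) \<in> A}"
    using assms by (auto simp: mv_holomorphic_on_def)
  then show "(\<lambda>w. g (z(i := w))) holomorphic_on {w. z(i := w) \<in> B}"
    by (rule holomorphic_on_subset) (use assms in auto)
qed

lemma mv_holomorphic_const: "mv_holomorphic_on e (\<lambda>_. c) A"
  by (simp add: mv_holomorphic_on_def)

lemma mv_holomorphic_coordinate:
  assumes "\<And>z. z \<in> A \<Longrightarrow> z i \<in> S" "h holomorphic_on S"
  shows "mv_holomorphic_on e (\<lambda>z. h (z i)) A"
  unfolding mv_holomorphic_on_def
proof (intro conjI ballI)
  show "continuous_on A (\<lambda>z. h (z i))"
    by (rule continuous_on_compose2[OF holomorphic_on_imp_continuous_on[OF assms(2)]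
          continuous_on_subset[OF continuous_on_product_coordinates subset_UNIV]])
       (use assms(1) in auto)
  fix z j assume "z \<in> A" "j \<in> {1..e}"
  show "(\<lambda>w. h ((z(j := w)) i)) holomorphic_on {w. z(j := w) \<in> A}"
  proof (cases "i = j")
    case True
    then show ?thesis using assms by (force intro: holomorphic_on_subset)
  qed simp
qed

lemma mv_holomorphic_compose:
  assumes "mv_holomorphic_on e g A" "h holomorphic_on S" "\<And>z. z \<in> A \<Longrightarrow> g z \<in> S"
  shows "mv_holomorphic_on e (\<lambda>z. h (g z)) A"
  unfolding mv_holomorphic_on_def
proof (intro conjI ballI)
  show "continuous_on A (\<lambda>z. h (g z))"
    by (rule continuous_on_compose2[OF holomorphic_on_imp_continuous_on[OF assms(2)]])
       (use assms in \<open>auto simp: mv_holomorphic_on_def\<close>)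
  fix z j assume z: "z \<in> A" "j \<in> {1..e}"
  then have "(\<lambda>w. g (z(j := w))) holomorphic_on {w. z(j := w) \<in> A}"
    using assms(1) by (auto simp: mv_holomorphic_on_def)
  from holomorphic_on_compose_gen[OF this assms(2)] assms(3)
  show "(\<lambda>w. h (g (z(j := w)))) holomorphic_on {w. z(j := w) \<in> A}"
    by (auto simp: o_def)
qed

lemma mv_holomorphic_mult:
  "mv_holomorphic_on e g A \<Longrightarrow> mv_holomorphic_on e h A \<Longrightarrow> mv_holomorphic_on e (\<lambda>z. g z * h z) A"
  by (auto simp: mv_holomorphic_on_def intro!: continuous_intros holomorphic_intros)

lemma mv_holomorphic_diff:
  "mv_holomorphic_on e g A \<Longrightarrow> mv_holomorphic_on e h A \<Longrightarrow> mv_holomorphic_on e (\<lambda>z. g z - h z) A"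
  by (auto simp: mv_holomorphic_on_def intro!: continuous_intros holomorphic_intros)

lemma mv_holomorphic_prod:
  "(\<And>i. i \<in> I \<Longrightarrow> mv_holomorphic_on e (g i) A) \<Longrightarrow> mv_holomorphic_on e (\<lambda>z. \<Prod>i\<in>I. g i z) A"
  by (auto simp: mv_holomorphic_on_def intro!: continuous_intros holomorphic_intros)

lemma mv_holomorphic_sum:
  "(\<And>i. i \<in> I \<Longrightarrow> mv_holomorphic_on e (g i) A) \<Longrightarrow> mv_holomorphic_on e (\<lambda>z. \<Sum>i\<in>I. g i z) A"
  by (auto simp: mv_holomorphic_on_def intro!: continuous_intros holomorphic_intros)

text \<open>Weierstrass M-test along the net of finite subsets. The uniform limit is continuous, and
  in each variable it is a uniform limit of holomorphic functions of one variable.\<close>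

lemma mv_holomorphic_infsum:
  assumes hol: "\<And>x. x \<in> X \<Longrightarrow> mv_holomorphic_on e (g x) (polydisc e p r)"
    and le: "\<And>x z. x \<in> X \<Longrightarrow> z \<in> polydisc e p r \<Longrightarrow> norm (g x z) \<le> M x"
    and M: "M summable_on X"
  shows "mv_holomorphic_on e (\<lambda>z. \<Sum>\<^sub>\<infinity>x\<in>X. g x z) (polydisc e p r)"
proof -
  let ?A = "polydisc e p r" and ?F = "finite_subsets_at_top X"
  have ul: "uniform_limit ?A (\<lambda>Y z. \<Sum>x\<in>Y. g x z) (\<lambda>z. \<Sum>\<^sub>\<infinity>x\<in>X. g x z) ?F"
    by (rule Weierstrass_m_test_general[OF le M])
  have ev: "\<forall>\<^sub>F Y in ?F. mv_holomorphic_on e (\<lambda>z. \<Sum>x\<in>Y. g x z) ?A"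
    by (rule eventually_finite_subsets_at_top_weakI) (use hol in \<open>auto intro!: mv_holomorphic_sum\<close>)
  show ?thesis unfolding mv_holomorphic_on_def
  proof (intro conjI ballI)
    show "continuous_on ?A (\<lambda>z. \<Sum>\<^sub>\<infinity>x\<in>X. g x z)"
      by (rule uniform_limit_theorem[OF _ ul])
         (use ev in \<open>auto simp: mv_holomorphic_on_def elim: eventually_mono\<close>)
    fix z i assume z: "z \<in> ?A" "i \<in> {1..e}"
    have S: "{w. z(i := w) \<in> ?A} = ball (p i) r"
      by (simp add: polydisc_update[OF z] ball_def dist_commute)
    show "(\<lambda>w. \<Sum>\<^sub>\<infinity>x\<in>X. g x (z(i := w))) holomorphic_on {w. z(i := w) \<in> ?A}"
      unfolding S
      unfolding holomorphic_on_open[OF open_ball]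
    proof
      fix w assume "w \<in> ball (p i) r"
      \<comment> \<open>The one-variable limit theorem asks for continuity on the closed disc, so a
        smaller closed disc inside the slice is taken.\<close>
      then obtain \<delta> where \<delta>: "\<delta> > 0" "cball w \<delta> \<subseteq> ball (p i) r"
        using open_contains_cball open_ball by meson
      have ul': "uniform_limit (cball w \<delta>) (\<lambda>Y w. \<Sum>x\<in>Y. g x (z(i := w)))
          (\<lambda>w. \<Sum>\<^sub>\<infinity>x\<in>X. g x (z(i := w))) ?F"
        by (rule uniform_limit_compose'[OF ul]) (use \<delta> S in blast)
      have ev': "\<forall>\<^sub>F Y in ?F. continuous_on (cball w \<delta>) (\<lambda>w. \<Sum>x\<in>Y. g x (z(i := w)))
          \<and> (\<lambda>w. \<Sum>x\<in>Y. g x (z(i := w))) holomorphic_on ball w \<delta>"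
        using ev
      proof eventually_elim
        case (elim Y)
        then have "(\<lambda>w. \<Sum>x\<in>Y. g x (z(i := w))) holomorphic_on ball (p i) r"
          using z unfolding mv_holomorphic_on_def S[symmetric] by blast
        then have "(\<lambda>w. \<Sum>x\<in>Y. g x (z(i := w))) holomorphic_on cball w \<delta>"
          using \<delta>(2) holomorphic_on_subset by blast
        then show ?case
          using ball_subset_cball holomorphic_on_imp_continuous_on holomorphic_on_subset by blast
      qed
      have "(\<lambda>w. \<Sum>\<^sub>\<infinity>x\<in>X. g x (z(i := w))) holomorphic_on ball w \<delta>"
        by (rule holomorphic_uniform_limit[OF ev' ul' finite_subsets_at_top_neq_bot])
      then show "\<exists>f'. ((\<lambda>w. \<Sum>\<^sub>\<infinity>x\<in>X. g x (z(i := w))) has_field_derivative f') (at w)"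
        using \<delta>(1) by (simp add: holomorphic_on_open)
    qed
  qed
qed


section \<open>The identity theorem on polydiscs and its consequences for generic equality\<close>

text \<open>The zeros spread one coordinate at a time: a slice of the polydisc is a disc, and the
  one-variable identity theorem extends the zeros from a small disc around a coordinate of
  \<open>a\<close> to the whole slice.\<close>

lemma polydisc_identity:
  assumes hol: "mv_holomorphic_on e g (polydisc e p r)"
    and V: "openin (top_of_set (cspace e)) V" "V \<inter> polydisc e p r \<noteq> {}"
    and zero: "\<And>z. z \<in> V \<inter> polydisc e p r \<Longrightarrow> g z = 0"
    and z: "z \<in> polydisc e p r"
  shows "g z = 0"
proof -
  obtain a where a: "a \<in> V \<inter> polydisc e p r" using V by blast
  have "openin (top_of_set (cspace e)) (V \<inter> polydisc e p r)"
    using V(1) openin_polydisc by blast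
  from polydisc_base[OF this a] obtain \<epsilon> where
    \<epsilon>: "\<epsilon> > 0" "polydisc e a \<epsilon> \<subseteq> V \<inter> polydisc e p r" by metis
  \<comment> \<open>The first \<open>m\<close> coordinates are already free, while the later ones
    stay close to \<open>a\<close>. The case \<open>m = 0\<close> is the small polydisc around
    \<open>a\<close>, the case \<open>m = e\<close> is the goal.\<close>
  have "\<forall>z \<in> polydisc e p r. (\<forall>i\<in>{m+1..e}. dist (z i) (a i) < \<epsilon>) \<longrightarrow> g z = 0" if "m \<le> e" for m
    using that
  proof (induction m)
    case 0
    show ?case
    proof (intro ballI impI)
      fix z assume "z \<in> polydisc e p r" "\<forall>i\<in>{0 + 1..e}. dist (z i) (a i) < \<epsilon>"
      then have "z \<in> polydisc e a \<epsilon>" by (auto simp: polydisc_def)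
      then show "g z = 0" using \<epsilon> zero by blast
    qed
  next
    case (Suc m)
    show ?case
    proof (intro ballI impI)
      fix z assume z: "z \<in> polydisc e p r" and d: "\<forall>i\<in>{Suc m + 1..e}. dist (z i) (a i) < \<epsilon>"
      let ?i = "Suc m"
      have i: "?i \<in> {1..e}" using Suc by auto
      let ?S = "{w. z(?i := w) \<in> polydisc e p r}"
      have S: "?S = ball (p ?i) r" by (simp add: polydisc_update[OF z i] ball_def dist_commute)
      have h: "(\<lambda>w. g (z(?i := w))) holomorphic_on ball (p ?i) r"
        using hol z i unfolding mv_holomorphic_on_def S[symmetric] by blast
      have aS: "a ?i \<in> ball (p ?i) r" using a i by (auto simp: polydisc_def dist_commute)
      have "(\<lambda>w. g (z(?i := w))) (z ?i) = 0"
      proof (rule analytic_continuation_open[where s = "ball (a ?i) \<epsilon> \<inter> ball (p ?i) r" and g = "\<lambda>_. 0", OF _ _ _ _ _ h])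
        show "ball (a ?i) \<epsilon> \<inter> ball (p ?i) r \<noteq> {}"
          using aS \<epsilon>(1) centre_in_ball[of "a ?i" \<epsilon>] by blast
        fix w assume w: "w \<in> ball (a ?i) \<epsilon> \<inter> ball (p ?i) r"
        show "g (z(?i := w)) = 0"
        proof (rule Suc.IH[rule_format])
          show "z(?i := w) \<in> polydisc e p r" using w S by blast
          show "dist ((z(?i := w)) j) (a j) < \<epsilon>" if "j \<in> {m + 1..e}" for j
            using that d w by (cases "j = ?i") (auto simp: dist_commute)
        qed (use Suc in auto)
      qed (use S z in auto)
      then show "g z = 0" by simp
    qed
  qed
  from this[of e] z show ?thesis by auto
qed

text \<open>If the zeros filled a nonempty relatively open part of the polydisc, the identity
  theorem would make \<open>g\<close> vanish everywhere on it.\<close>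

lemma nonzero_set_dense:
  assumes hol: "mv_holomorphic_on e g (polydisc e p r)" and "\<exists>z\<in>polydisc e p r. g z \<noteq> 0"
  shows "openin (top_of_set (cspace e)) {z \<in> polydisc e p r. g z \<noteq> 0}"
    and "polydisc e p r \<subseteq> closure {z \<in> polydisc e p r. g z \<noteq> 0}"
proof -
  have "openin (top_of_set (polydisc e p r)) (polydisc e p r \<inter> g -` (- {0}))"
    using hol by (intro continuous_openin_preimage_gen) (auto simp: mv_holomorphic_on_def)
  moreover have "polydisc e p r \<inter> g -` (- {0}) = {z \<in> polydisc e p r. g z \<noteq> 0}" by auto
  ultimately show "openin (top_of_set (cspace e)) {z \<in> polydisc e p r. g z \<noteq> 0}"
    using openin_polydisc openin_trans by metis
  show "polydisc e p r \<subseteq> closure {z \<in> polydisc e p r. g z \<noteq> 0}"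
  proof (rule denseI[OF polydisc_subset_cspace])
    fix V assume V: "openin (top_of_set (cspace e)) V" "V \<inter> polydisc e p r \<noteq> {}"
    show "V \<inter> {z \<in> polydisc e p r. g z \<noteq> 0} \<noteq> {}"
      using polydisc_identity[OF hol V] assms(2) by blast
  qed
qed

text \<open>The standard source of generic equalities below: an identity that holds wherever some
  common denominator \<open>h\<close> is nonzero.\<close>

lemma generically_eq_on_nonzero:
  assumes "mv_holomorphic_on e h (polydisc e p r)" "\<exists>z\<in>polydisc e p r. h z \<noteq> 0"
    and "\<And>z. z \<in> polydisc e p r \<Longrightarrow> h z \<noteq> 0 \<Longrightarrow> F z = G z"
  shows "generically_eq_on e (polydisc e p r) F G"
  unfolding generically_eq_on_def
proof (intro exI conjI)
  show "openin (top_of_set (cspace e)) {z \<in> polydisc e p r. h z \<noteq> 0}"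
    and "polydisc e p r \<subseteq> closure {z \<in> polydisc e p r. h z \<noteq> 0}"
    using nonzero_set_dense[OF assms(1,2)] .
qed (use assms(3) in blast)+

section \<open>Uniqueness of meromorphic functions\<close>

text \<open>As a subset of all functions on the naturals, \<open>cspace e\<close> is a full product
  whose factors outside \<open>{1..e}\<close> are the singleton of \<open>undefined\<close>, so
  connectedness of products applies.\<close>

lemma connected_cspace: "connected (cspace e)"
proof -
  have "connectedin (product_topology (\<lambda>i. euclidean :: complex topology) UNIV)
      (PiE UNIV (\<lambda>i. if i \<in> {1..e} then UNIV else {undefined}))"
    by (subst connectedin_PiE) auto
  moreover have "PiE UNIV (\<lambda>i. if i \<in> {1..e} then UNIV else {undefined}) = cspace e"
    (is "?L = _")
  proof -
    have "x i \<in> (if i \<in> {1..e} then UNIV else {undefined}) \<longleftrightarrow> (i \<notin> {1..e} \<longrightarrow> x i = undefined)"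
      for x :: "nat \<Rightarrow> complex" and i by simp
    then have "x \<in> ?L \<longleftrightarrow> x \<in> cspace e" for x
      unfolding cspace_def PiE_iff extensional_def by blast
    then show ?thesis by blast
  qed
  ultimately show ?thesis by (simp add: euclidean_product_topology)
qed

text \<open>The closure of the interior of the coincidence set is open, because near each point the
  coincidence set is either dense or nowhere dense.\<close>

lemma mv_meromorphic_unique:
  assumes F: "mv_meromorphic e F" and G: "mv_meromorphic e G"
    and V: "openin (top_of_set (cspace e)) V" "V \<noteq> {}" and eq: "\<And>z. z \<in> V \<Longrightarrow> F z = G z"
  shows "generically_eq_on e (cspace e) F G"
proof -
  define W where "W = \<Union>{V. openin (top_of_set (cspace e)) V \<and> (\<forall>z\<in>V. F z = G z)}"
  have W_open: "openin (top_of_set (cspace e)) W"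
    unfolding W_def by (intro openin_Union) auto
  have W_eq: "F z = G z" if "z \<in> W" for z using that by (auto simp: W_def)
  have W_max: "V \<subseteq> W" if "openin (top_of_set (cspace e)) V" "\<forall>z\<in>V. F z = G z" for V
    using that by (auto simp: W_def)
  have W_sub: "W \<subseteq> cspace e" using openin_imp_subset[OF W_open] .
  have loc: "\<exists>r>0. polydisc e p r \<subseteq> closure W \<or> polydisc e p r \<inter> W = {}" if p: "p \<in> cspace e" for p
  proof -
    obtain r1 g1 h1 where 1: "r1 > 0" "mv_holomorphic_on e g1 (polydisc e p r1)"
      "mv_holomorphic_on e h1 (polydisc e p r1)" "\<exists>z\<in>polydisc e p r1. h1 z \<noteq> 0"
      "generically_eq_on e (polydisc e p r1) F (\<lambda>z. g1 z / h1 z)"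
      using F p unfolding mv_meromorphic_def by meson
    obtain r2 g2 h2 where 2: "r2 > 0" "mv_holomorphic_on e g2 (polydisc e p r2)"
      "mv_holomorphic_on e h2 (polydisc e p r2)" "\<exists>z\<in>polydisc e p r2. h2 z \<noteq> 0"
      "generically_eq_on e (polydisc e p r2) G (\<lambda>z. g2 z / h2 z)"
      using G p unfolding mv_meromorphic_def by meson
    define r where "r = min r1 r2"
    let ?A = "polydisc e p r"
    have r: "r > 0" "?A \<subseteq> polydisc e p r1" "?A \<subseteq> polydisc e p r2"
      using 1(1) 2(1) polydisc_mono[of r r1 e p] polydisc_mono[of r r2 e p] by (simp_all add: r_def)
    \<comment> \<open>By the identity theorem a denominator that is not identically zero on the
      larger polydisc stays so on the common smaller one.\<close>
    have nz: "\<exists>z\<in>?A. h z \<noteq> 0" if "mv_holomorphic_on e h (polydisc e p r')"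
      "\<exists>z\<in>polydisc e p r'. h z \<noteq> 0" "?A \<subseteq> polydisc e p r'" for h r'
      using polydisc_identity[OF that(1) openin_polydisc[of e p r]] that(2,3)
        polydisc_center[OF p r(1)] by blast
    \<comment> \<open>The numerator of the difference of the two local quotients; whether it
      vanishes identically decides between the two alternatives.\<close>
    define \<phi> where "\<phi> = (\<lambda>z. g1 z * h2 z - g2 z * h1 z)"
    note hol = 1(2,3)[THEN mv_holomorphic_on_subset[OF _ r(2)]]
      2(2,3)[THEN mv_holomorphic_on_subset[OF _ r(3)]]
    have \<phi>_hol: "mv_holomorphic_on e \<phi> ?A"
      unfolding \<phi>_def by (intro mv_holomorphic_diff mv_holomorphic_mult hol)
    \<comment> \<open>The values 0 and 1 encode a conjunction as an equation, because generic
      equality speaks of equations only.\<close>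
    have "generically_eq_on e ?A (\<lambda>z. if F z = g1 z / h1 z \<and> h1 z \<noteq> 0 then 0 else 1) (\<lambda>_. 0)"
      by (rule generically_eq_on_combine[OF
            generically_eq_on_subset[OF 1(5) openin_polydisc r(2) polydisc_subset_cspace]
            generically_eq_on_nonzero[OF hol(2) nz[OF 1(3,4) r(2)],
              where F = "\<lambda>z. if h1 z \<noteq> 0 then 0 else 1" and G = "\<lambda>_. 0"]])
         (auto simp: polydisc_subset_cspace split: if_splits)
    moreover
    have "generically_eq_on e ?A (\<lambda>z. if G z = g2 z / h2 z \<and> h2 z \<noteq> 0 then 0 else 1) (\<lambda>_. 0)"
      by (rule generically_eq_on_combine[OF
            generically_eq_on_subset[OF 2(5) openin_polydisc r(3) polydisc_subset_cspace]
            generically_eq_on_nonzero[OF hol(4) nz[OF 2(3,4) r(3)],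
              where F = "\<lambda>z. if h2 z \<noteq> 0 then 0 else 1" and G = "\<lambda>_. 0"]])
         (auto simp: polydisc_subset_cspace split: if_splits)
    ultimately have "generically_eq_on e ?A
        (\<lambda>z. if F z = g1 z / h1 z \<and> h1 z \<noteq> 0 \<and> G z = g2 z / h2 z \<and> h2 z \<noteq> 0 then 0 else 1) (\<lambda>_. 0)"
      by (rule generically_eq_on_combine) (auto simp: polydisc_subset_cspace split: if_splits)
    then obtain W0 where W0: "W0 \<subseteq> ?A" "openin (top_of_set (cspace e)) W0" "?A \<subseteq> closure W0"
      "\<And>z. z \<in> W0 \<Longrightarrow> F z = g1 z / h1 z \<and> h1 z \<noteq> 0 \<and> G z = g2 z / h2 z \<and> h2 z \<noteq> 0"
      unfolding generically_eq_on_def by (metis zero_neq_one)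
    show ?thesis
    proof (cases "\<forall>z\<in>?A. \<phi> z = 0")
      case True
      have "W0 \<subseteq> W"
      proof (rule W_max[OF W0(2)], rule ballI)
        fix z assume z: "z \<in> W0"
        then have "\<phi> z = 0" using True W0(1) by blast
        then show "F z = G z" using W0(4)[OF z] by (auto simp: \<phi>_def frac_eq_eq)
      qed
      then have "?A \<subseteq> closure W" using W0(3) closure_mono by blast
      then show ?thesis using r(1) by blast
    next
      case False
      then have ne: "\<exists>z\<in>?A. \<phi> z \<noteq> 0" by blast
      note N = nonzero_set_dense[OF \<phi>_hol ne]
      let ?N = "{z \<in> ?A. \<phi> z \<noteq> 0}"
      have d: "?A \<subseteq> closure (W0 \<inter> ?N)"
        by (rule dense_open_Int[OF W0(2) N(1) W0(1) _ W0(3) N(2) polydisc_subset_cspace]) auto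
      have "?A \<inter> W = {}"
      proof (rule ccontr)
        assume "?A \<inter> W \<noteq> {}"
        then have "W \<inter> (W0 \<inter> ?N) \<noteq> {}"
          using dense_meets_open[OF d W_open] polydisc_subset_cspace[of e p r] by blast
        then obtain z where z: "z \<in> W" "z \<in> W0" "\<phi> z \<noteq> 0" by blast
        then have "g1 z / h1 z = g2 z / h2 z" "h1 z \<noteq> 0" "h2 z \<noteq> 0"
          using W_eq[OF z(1)] W0(4)[OF z(2)] by auto
        then show False using z(3) by (simp add: \<phi>_def frac_eq_eq)
      qed
      then show ?thesis using r(1) by blast
    qed
  qed
  let ?T = "cspace e \<inter> closure W"
  have "openin (top_of_set (cspace e)) ?T"
  proof (subst openin_subopen, rule ballI)
    fix p assume p: "p \<in> ?T"
    then obtain r where r: "r > 0" "polydisc e p r \<subseteq> closure W \<or> polydisc e p r \<inter> W = {}"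
      using loc by blast
    \<comment> \<open>Since \<open>p\<close> is in the closure of \<open>W\<close>, its
      neighbourhood meets \<open>W\<close>; this excludes the second alternative.\<close>
    moreover have "polydisc e p r \<inter> W \<noteq> {}"
      using dense_meets_open[of "{p}" W e "polydisc e p r"] polydisc_center[of p e r] p r(1)
        openin_polydisc W_sub by blast
    ultimately have "polydisc e p r \<subseteq> ?T" "p \<in> polydisc e p r"
      using polydisc_center[of p e r] p polydisc_subset_cspace[of e p r] by auto
    then show "\<exists>T. openin (top_of_set (cspace e)) T \<and> p \<in> T \<and> T \<subseteq> ?T"
      using openin_polydisc by (intro exI[of _ "polydisc e p r"]) simp
  qed
  moreover have "closedin (top_of_set (cspace e)) ?T"
    by (simp add: closedin_closed_Int)
  ultimately have "?T = {} \<or> ?T = cspace e"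
    using connected_cspace connected_clopen by blast
  moreover have "?T \<noteq> {}"
    using W_max[OF V(1)] eq V(2) W_sub closure_subset[of W] by blast
  ultimately have "cspace e \<subseteq> closure W" by blast
  then show ?thesis
    unfolding generically_eq_on_def using W_open W_sub W_eq by (intro exI[of _ W]) simp
qed


subsection \<open>Geometric sums over increasing tuples\<close>

text \<open>Absolute convergence of the factors carries over to the expanded product, which turns an
  identity between values of \<open>infsum\<close> into genuine convergence.\<close>

lemma has_sum_prod_PiE:
  fixes f :: "'a \<Rightarrow> nat \<Rightarrow> 'c :: {real_normed_field, banach, second_countable_topology}"
  assumes "finite A" "\<And>x. x \<in> A \<Longrightarrow> (\<lambda>y. norm (f x y)) summable_on B x"
    and "\<And>x. x \<in> A \<Longrightarrow> (f x has_sum S x) (B x)"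
  shows "(\<lambda>g. norm (\<Prod>x\<in>A. f x (g x))) summable_on PiE A B"
    and "((\<lambda>g. \<Prod>x\<in>A. f x (g x)) has_sum (\<Prod>x\<in>A. S x)) (PiE A B)"
proof -
  show *: "(\<lambda>g. norm (\<Prod>x\<in>A. f x (g x))) summable_on PiE A B"
    using Infinite_Set_Sum.abs_summable_on_prod_PiE[of A B f] assms(1,2)
    by (simp add: abs_summable_equivalent[symmetric])
  have "infsum (\<lambda>g. \<Prod>x\<in>A. f x (g x)) (PiE A B) = (\<Prod>x\<in>A. infsum (f x) (B x))"
    by (rule infsum_prod_PiE_abs) (use assms in auto)
  also have "\<dots> = (\<Prod>x\<in>A. S x)"
    using assms(3) by (intro prod.cong) (auto simp: infsumI)
  finally show "((\<lambda>g. \<Prod>x\<in>A. f x (g x)) has_sum (\<Prod>x\<in>A. S x)) (PiE A B)"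
    using abs_summable_summable[OF *] by (metis has_sum_infsum)
qed

definition partial_sums :: "nat \<Rightarrow> (nat \<Rightarrow> nat) \<Rightarrow> nat \<Rightarrow> nat" where
  "partial_sums e m = (\<lambda>i\<in>{1..e}. \<Sum>j=1..i. m j)"

text \<open>The inverse map takes the gaps between consecutive entries; strict increase and
  positivity of the tuple say exactly that all gaps are at least 1.\<close>

lemma bij_betw_partial_sums:
  "bij_betw (partial_sums e) ({1..e} \<rightarrow>\<^sub>E {1..}) (increasing_tuples e)"
proof -
  \<comment> \<open>The entry before the first one counts as 0. It needs a separate case, since a
    tuple is \<open>undefined\<close> at index 0.\<close>
  define diff :: "(nat \<Rightarrow> nat) \<Rightarrow> nat \<Rightarrow> nat" where
    "diff n = (\<lambda>i\<in>{1..e}. n i - (if i = 1 then 0 else n (i - 1)))" for n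
  have step: "partial_sums e m i - (if i = 1 then 0 else partial_sums e m (i - 1)) = m i"
    if "i \<in> {1..e}" for m i
  proof (cases "i = 1")
    case False
    then obtain k where "i = Suc k" "k \<ge> 1" using \<open>i \<in> {1..e}\<close> by (cases i) auto
    then show ?thesis using that by (simp add: partial_sums_def)
  qed (use that in \<open>simp add: partial_sums_def\<close>)
  have sum_diff: "(\<Sum>j=1..i. diff n j) = n i"
    if n: "n \<in> increasing_tuples e" and "i \<ge> 1" "i \<le> e" for n i
    using that(2,3)
  proof (induction i rule: dec_induct)
    case base
    then show ?case by (simp add: diff_def)
  next
    case (step k)
    have "n k < n (Suc k)" using n step unfolding increasing_tuples_def strict_mono_on_def by auto
    then show ?case using step by (simp add: diff_def)
  qed
  show ?thesis
  proof (rule bij_betw_byWitness[where f' = diff])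
    show "\<forall>m\<in>{1..e} \<rightarrow>\<^sub>E {1..}. diff (partial_sums e m) = m"
      using step by (fastforce simp: diff_def PiE_iff extensional_def)
    show "\<forall>n\<in>increasing_tuples e. partial_sums e (diff n) = n"
    proof
      fix n assume n: "n \<in> increasing_tuples e"
      then have "n i = undefined" if "i \<notin> {1..e}" for i
        using that unfolding increasing_tuples_def PiE_iff extensional_def by blast
      with sum_diff[OF n] show "partial_sums e (diff n) = n"
        by (intro ext) (auto simp: partial_sums_def)
    qed
    show "partial_sums e ` ({1..e} \<rightarrow>\<^sub>E {1..}) \<subseteq> increasing_tuples e"
    proof (rule image_subsetI)
      fix m :: "nat \<Rightarrow> nat" assume m: "m \<in> {1..e} \<rightarrow>\<^sub>E {1..}"
      then have pos: "m i > 0" if "i \<in> {1..e}" for i using that by (force simp: PiE_iff)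
      have lt: "(\<Sum>j=1..i. m j) < (\<Sum>j=1..i'. m j)" if "i < i'" "i' \<le> e" for i i'
        by (rule sum_strict_mono2[where b = i']) (use that pos in auto)
      \<comment> \<open>The instance at 0 compares with the empty sum and yields positivity of the
        entries.\<close>
      show "partial_sums e m \<in> increasing_tuples e"
        using lt lt[of 0] unfolding increasing_tuples_def strict_mono_on_def partial_sums_def by auto
    qed
    show "diff ` increasing_tuples e \<subseteq> {1..e} \<rightarrow>\<^sub>E {1..}"
    proof (rule image_subsetI)
      fix n assume n: "n \<in> increasing_tuples e"
      have "diff n i \<ge> 1" if i: "i \<in> {1..e}" for i
      proof (cases "i = 1")
        case True
        then show ?thesis using n i by (auto simp: diff_def increasing_tuples_def Suc_le_eq)
      next
        case False
        then have "i - 1 \<in> {1..e}" "i - 1 < i" using i by auto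
        then have "n (i - 1) < n i"
          using n i unfolding increasing_tuples_def strict_mono_on_def by blast
        then show ?thesis using i False by (simp add: diff_def)
      qed
      then show "diff n \<in> {1..e} \<rightarrow>\<^sub>E {1..}"
        by (auto simp: PiE_iff diff_def)
    qed
  qed
qed

lemma prod_triangle_swap:
  fixes g :: "nat \<Rightarrow> nat \<Rightarrow> 'a :: comm_monoid_mult"
  shows "(\<Prod>i=1..e. \<Prod>j=1..i. g i j) = (\<Prod>j=1..e. \<Prod>i=j..e. g i j)"
proof -
  have "(\<Prod>i=1..e. \<Prod>j=1..i. g i j) = (\<Prod>(i, j)\<in>(SIGMA i:{1..e}. {1..i}). g i j)"
    by (rule prod.Sigma) auto
  also have "\<dots> = (\<Prod>(j, i)\<in>(SIGMA j:{1..e}. {j..e}). g i j)"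
    by (rule prod.reindex_bij_witness[where i = prod.swap and j = prod.swap]) auto
  also have "\<dots> = (\<Prod>j=1..e. \<Prod>i=j..e. g i j)"
    by (rule prod.Sigma[symmetric]) auto
  finally show ?thesis .
qed

text \<open>The gap \<open>m j\<close> enters every partial sum with index \<open>i \<ge> j\<close>,
  so the base it is an exponent of is the product of the \<open>y i\<close> over these
  \<open>i\<close>.\<close>

lemma prod_power_partial_sums:
  fixes y :: "nat \<Rightarrow> 'a :: comm_semiring_1"
  shows "(\<Prod>i=1..e. y i ^ partial_sums e m i) = (\<Prod>j=1..e. (\<Prod>i=j..e. y i) ^ m j)"
proof -
  have "(\<Prod>i=1..e. y i ^ partial_sums e m i) = (\<Prod>i=1..e. \<Prod>j=1..i. y i ^ m j)"
    by (intro prod.cong) (auto simp: partial_sums_def power_sum)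
  then show ?thesis unfolding prod_triangle_swap prod_power_distrib .
qed

text \<open>In the gap variables the sum becomes a product of independent geometric series, each
  starting at exponent 1.\<close>

lemma has_sum_increasing_tuples:
  fixes y :: "nat \<Rightarrow> 'a :: {real_normed_field, banach, second_countable_topology}"
  assumes "\<And>j. j \<in> {1..e} \<Longrightarrow> norm (\<Prod>i=j..e. y i) < 1"
  shows "(\<lambda>n. norm (\<Prod>i=1..e. y i ^ n i)) summable_on increasing_tuples e"
    and "((\<lambda>n. \<Prod>i=1..e. y i ^ n i) has_sum
           (\<Prod>j=1..e. (\<Prod>i=j..e. y i) / (1 - (\<Prod>i=j..e. y i)))) (increasing_tuples e)"
proof -
  let ?z = "\<lambda>j. \<Prod>i=j..e. y i"
  have hs: "((\<lambda>m. ?z j ^ m) has_sum (?z j / (1 - ?z j))) {1..}"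
    if "j \<in> {1..e}" for j
    using has_sum_geometric_from_1 assms[OF that] by blast
  have ns: "(\<lambda>m. norm (?z j ^ m)) summable_on {1..}" if "j \<in> {1..e}" for j
    using has_sum_geometric_from_1[of "norm (?z j)"] assms[OF that]
    by (auto simp: norm_power summable_on_def)
  note * = has_sum_prod_PiE[of "{1..e}" "\<lambda>j m. ?z j ^ m" "\<lambda>_. {1..}", OF finite_atLeastAtMost ns hs]
  show "(\<lambda>n. norm (\<Prod>i=1..e. y i ^ n i)) summable_on increasing_tuples e"
    using *(1) summable_on_reindex_bij_betw[OF bij_betw_partial_sums[of e],
        of "\<lambda>n. norm (\<Prod>i=1..e. y i ^ n i)"]
    by (simp only: prod_power_partial_sums)
  show "((\<lambda>n. \<Prod>i=1..e. y i ^ n i) has_sum (\<Prod>j=1..e. ?z j / (1 - ?z j))) (increasing_tuples e)"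
    using *(2) has_sum_reindex_bij_betw[OF bij_betw_partial_sums[of e],
        of "\<lambda>n. \<Prod>i=1..e. y i ^ n i"]
    by (simp only: prod_power_partial_sums)
qed

subsection \<open>The binomial series\<close>

text \<open>The sign from reflecting the upper index cancels the sign of \<open>(-x) ^ k\<close>.
  The Pochhammer form is preferred because its modulus is easily majorized.\<close>

lemma gbinomial_minus_power:
  fixes s x :: "'a :: field_char_0"
  shows "((-s) gchoose k) * (-x) ^ k = pochhammer s k / fact k * x ^ k"
proof -
  have "(-x) ^ k = (-1) ^ k * x ^ k" by (rule power_minus)
  then have "((-s) gchoose k) * (-x) ^ k = ((-1) ^ k * (-1) ^ k) * (pochhammer s k / fact k * x ^ k)"
    by (simp only: gbinomial_pochhammer minus_minus times_divide_eq_left times_divide_eq_right ac_simps)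
  also have "(-1) ^ k * (-1) ^ k = (1 :: 'a)"
    by (simp flip: power_mult_distrib)
  finally show ?thesis by simp
qed

text \<open>This is the real binomial series of \<open>(1 - \<rho>) powr (-M)\<close>; it supplies
  the majorants for all M-tests below.\<close>

lemma summable_pochhammer_power:
  fixes M \<rho> :: real
  assumes "0 \<le> \<rho>" "\<rho> < 1"
  shows "summable (\<lambda>k. pochhammer M k / fact k * \<rho> ^ k)"
proof -
  have "(\<lambda>k. ((-M) gchoose k) * (-\<rho>) ^ k) sums (1 + -\<rho>) powr (-M)"
    by (rule gen_binomial_real) (use assms in auto)
  then show ?thesis by (simp only: sums_iff gbinomial_minus_power)
qed

text \<open>Compare factor by factor with the triangle inequality. The bound is uniform for
  \<open>s\<close> in a disc.\<close>

lemma norm_pochhammer_le: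
  fixes s :: complex
  assumes "norm s \<le> M"
  shows "norm (pochhammer s k / fact k) \<le> pochhammer M k / fact k"
proof -
  have "norm (pochhammer s k) \<le> pochhammer M k"
    unfolding pochhammer_prod prod_norm[symmetric]
  proof (intro prod_mono conjI)
    fix i
    show "norm (s + of_nat i) \<le> M + of_nat i"
      using norm_triangle_ineq[of s "of_nat i"] assms by simp
  qed auto
  then show ?thesis by (simp add: norm_divide divide_right_mono)
qed

lemma has_sum_pochhammer_power:
  fixes s x :: complex
  assumes "norm x < 1"
  shows "(\<lambda>k. norm (pochhammer s k / fact k * x ^ k)) summable_on UNIV"
    and "((\<lambda>k. pochhammer s k / fact k * x ^ k) has_sum ((1 - x) powr (-s))) UNIV"
proof -
  have "norm (pochhammer s k / fact k * x ^ k) \<le> pochhammer (norm s) k / fact k * norm x ^ k" for k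
    unfolding norm_mult norm_power by (intro mult_right_mono norm_pochhammer_le) auto
  then have sm: "summable (\<lambda>k. norm (pochhammer s k / fact k * x ^ k))"
    by (intro summable_comparison_test'[OF summable_pochhammer_power[of "norm x" "norm s"], of 0])
       (use assms in auto)
  then show "(\<lambda>k. norm (pochhammer s k / fact k * x ^ k)) summable_on UNIV"
    by (intro norm_summable_imp_summable_on) simp
  have "(\<lambda>k. ((-s) gchoose k) * (-x) ^ k) sums (1 + -x) powr (-s)"
    by (rule gen_binomial_complex) (use assms in auto)
  then have "(\<lambda>k. pochhammer s k / fact k * x ^ k) sums (1 - x) powr (-s)"
    by (simp only: gbinomial_minus_power add_uminus_conv_diff)
  with sm show "((\<lambda>k. pochhammer s k / fact k * x ^ k) has_sum ((1 - x) powr (-s))) UNIV"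
    by (rule norm_summable_imp_has_sum)
qed

text \<open>On \<open>[\<delta>, 2]\<close> the logarithm is bounded in modulus by
  \<open>\<bar>ln \<delta>\<bar> + ln 2\<close>, which gives a lower bound independent of
  \<open>x\<close>.\<close>

lemma norm_powr_ge:
  assumes "0 < \<delta>" "\<delta> \<le> x" "x \<le> 2"
  shows "exp (- (norm s * (\<bar>ln \<delta>\<bar> + ln 2))) \<le> norm (complex_of_real x powr s)"
proof -
  have x: "x > 0" using assms by simp
  have "ln \<delta> \<le> ln x" "ln x \<le> ln 2" "ln (2 :: real) > 0" using assms x by auto
  then have L: "\<bar>ln x\<bar> \<le> \<bar>ln \<delta>\<bar> + ln 2" by linarith
  have "norm (complex_of_real x powr s) = exp (Re s * ln x)"
    using x by (simp add: norm_powr_real_powr powr_def)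
  moreover have "\<bar>Re s * ln x\<bar> \<le> norm s * (\<bar>ln \<delta>\<bar> + ln 2)"
    unfolding abs_mult by (intro mult_mono L abs_Re_le_cmod) auto
  ultimately show ?thesis by (simp add: abs_le_iff)
qed


lemma pochhammer_real_nonneg: "0 \<le> M \<Longrightarrow> 0 \<le> pochhammer (M :: real) k"
  unfolding pochhammer_prod by (intro prod_nonneg) auto

subsection \<open>Multiple Lucas additive L-functions\<close>

text \<open>The bound \<open>N\<close> lets the depth vary: the residue formula compares two
  consecutive depths for one family of characters.\<close>

locale lucas_characters =
  fixes P Q :: real and f :: "nat \<Rightarrow> int \<Rightarrow> complex" and N :: nat
  assumes P_pos: "P > 0" and Q_nz: "Q \<noteq> 0"
    and small_P: "P \<le> 2 \<Longrightarrow> Q < P - 1"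
    and large_P: "P > 2 \<Longrightarrow> Q \<le> P - 1"
    and characters: "\<And>i. i \<in> {1..N} \<Longrightarrow> additive_character (f i)"
begin

abbreviation "D \<equiv> lucas_disc P Q"
abbreviation "\<alpha> \<equiv> lucas_alpha P Q"
abbreviation "\<beta> \<equiv> lucas_beta P Q"

section \<open>The roots of the characteristic polynomial and the size of their ratio\<close>

definition q :: real where "q = \<beta> / \<alpha>"

text \<open>The difference \<open>D - (P - 2)\<^sup>2\<close> equals \<open>4 * (P - 1 - Q)\<close>;
  equality with 0 is allowed only for \<open>P > 2\<close>.\<close>

lemma D_gt: "D > (P - 2)\<^sup>2 \<or> P > 2 \<and> D = (P - 2)\<^sup>2"
  using small_P large_P by (fastforce simp: lucas_disc_def power2_eq_square algebra_simps)

lemma D_pos: "D > 0"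
proof -
  have "(P - 2)\<^sup>2 \<ge> 0" "P > 2 \<Longrightarrow> (P - 2)\<^sup>2 > 0" by auto
  then show ?thesis using D_gt by linarith
qed

text \<open>The sum \<open>P + \<bar>P - 2\<bar>\<close> is at least 2, and it exceeds 2 when
  \<open>P > 2\<close>, which covers the case of equality.\<close>

lemma alpha_gt_1: "\<alpha> > 1"
proof -
  have "sqrt D > \<bar>P - 2\<bar> \<or> P > 2 \<and> sqrt D = \<bar>P - 2\<bar>"
    using D_gt by (metis real_sqrt_abs real_sqrt_less_iff)
  then have "P + sqrt D > 2" by linarith
  then show ?thesis by (simp add: lucas_alpha_def)
qed

lemma alpha_minus_beta: "\<alpha> - \<beta> = sqrt D"
  by (simp add: lucas_alpha_def lucas_beta_def field_simps)

lemma alpha_mult_beta: "\<alpha> * \<beta> = Q"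
proof -
  have "sqrt D * sqrt D = P\<^sup>2 - 4 * Q" using D_pos by (simp add: lucas_disc_def)
  then show ?thesis by (simp add: lucas_alpha_def lucas_beta_def field_simps power2_eq_square)
qed

lemma q_alt: "q = Q / \<alpha>\<^sup>2"
proof -
  have "\<beta> / \<alpha> = (\<alpha> * \<beta>) / (\<alpha> * \<alpha>)" using alpha_gt_1 by simp
  then show ?thesis by (simp only: q_def alpha_mult_beta power2_eq_square)
qed

lemma q_nz: "q \<noteq> 0"
  using Q_nz alpha_gt_1 by (simp add: q_alt)

lemma abs_q_less_1: "\<bar>q\<bar> < 1"
proof -
  have "\<bar>\<beta>\<bar> < \<alpha>"
    using P_pos real_sqrt_gt_zero[OF D_pos]
    by (simp add: lucas_alpha_def lucas_beta_def abs_less_iff field_simps)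
  then show ?thesis using alpha_gt_1 by (simp add: q_def abs_divide)
qed

lemma abs_q_pos: "0 < \<bar>q\<bar>" using q_nz by simp

lemma ln_alpha_pos: "ln \<alpha> > 0" using alpha_gt_1 by simp

lemma q_power_bounds:
  assumes "n > 0"
  shows "1 - \<bar>q\<bar> \<le> 1 - q ^ n" "1 - q ^ n \<le> 2" "0 < 1 - q ^ n"
proof -
  have "\<bar>q ^ n\<bar> \<le> \<bar>q\<bar>"
    using power_decreasing[of 1 n "\<bar>q\<bar>"] assms abs_q_less_1 by (simp add: power_abs)
  then show "1 - \<bar>q\<bar> \<le> 1 - q ^ n" "1 - q ^ n \<le> 2" "0 < 1 - q ^ n"
    using abs_q_less_1 by linarith+
qed

lemma lucas_U_eq: "lucas_U P Q n = \<alpha> ^ n * (1 - q ^ n) / sqrt D"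
proof -
  have "\<alpha> ^ n * (1 - q ^ n) = \<alpha> ^ n - \<beta> ^ n"
    using alpha_gt_1 by (simp add: q_def power_divide right_diff_distrib)
  then show ?thesis by (simp only: lucas_U_def alpha_minus_beta)
qed

section \<open>Expansion of the series into geometric sums indexed by multi-indices\<close>

text \<open>This is \<open>f j 1\<close> times the power of \<open>\<alpha>\<close> with exponent
  \<open>- s\<close>; the exponential form makes it visibly entire in \<open>s\<close>.\<close>

definition weight :: "nat \<Rightarrow> complex \<Rightarrow> complex" where
  "weight j s = f j 1 * exp (- s * of_real (ln \<alpha>))"

definition tail_weight :: "nat \<Rightarrow> (nat \<Rightarrow> complex) \<Rightarrow> nat \<Rightarrow> complex" where
  "tail_weight e s i = (\<Prod>j=i..e. weight j (s j))"

definition tail_sum :: "nat \<Rightarrow> (nat \<Rightarrow> nat) \<Rightarrow> nat \<Rightarrow> nat" where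
  "tail_sum e \<kappa> i = (\<Sum>j=i..e. \<kappa> j)"

definition disc_factor :: "nat \<Rightarrow> (nat \<Rightarrow> complex) \<Rightarrow> complex" where
  "disc_factor e s = (\<Prod>i=1..e. complex_of_real D powr (s i / 2))"

text \<open>The coefficient of \<open>x ^ k\<close> in \<open>(1 - x) powr (- s)\<close>, a binomial
  coefficient with sign.\<close>

definition coef :: "complex \<Rightarrow> nat \<Rightarrow> complex" where
  "coef s k = pochhammer s k / fact k"

definition G_term :: "nat \<Rightarrow> (nat \<Rightarrow> complex) \<Rightarrow> (nat \<Rightarrow> nat) \<Rightarrow> complex" where
  "G_term e s \<kappa> = (\<Prod>i=1..e. coef (s i) (\<kappa> i)) *
     (\<Prod>i=1..e. tail_weight e s i * of_real q ^ tail_sum e \<kappa> i /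
        (1 - tail_weight e s i * of_real q ^ tail_sum e \<kappa> i))"

definition G :: "nat \<Rightarrow> (nat \<Rightarrow> complex) \<Rightarrow> complex" where
  "G e s = disc_factor e s * (\<Sum>\<^sub>\<infinity>\<kappa>\<in>{1..e} \<rightarrow>\<^sub>E UNIV. G_term e s \<kappa>)"

lemma character_nz: "i \<in> {1..N} \<Longrightarrow> f i m \<noteq> 0"
  using characters by (auto simp: additive_character_def)

lemma character_power: "i \<in> {1..N} \<Longrightarrow> f i (int n) = f i 1 ^ n"
proof (induction n)
  case 0
  then have "f i (0 + 0) = f i 0 * f i 0" "f i 0 \<noteq> 0"
    using characters unfolding additive_character_def by blast+
  then show ?case by simp
next
  case (Suc n)
  then have "f i (int n + 1) = f i (int n) * f i 1"
    using characters unfolding additive_character_def by blast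
  then show ?case using Suc by (simp add: add.commute)
qed

lemma weight_nz: "i \<in> {1..N} \<Longrightarrow> weight i s \<noteq> 0"
  by (simp add: weight_def character_nz)

text \<open>All factors of \<open>U_n\<close> in its product form are positive, so its logarithm
  splits over the reals and no branch question arises for the complex powers.\<close>

lemma lucas_factor_eq:
  assumes "i \<in> {1..N}" "n > 0"
  shows "f i (int n) / (complex_of_real (lucas_U P Q n) powr s) =
    complex_of_real D powr (s / 2) * weight i s ^ n * complex_of_real (1 - q ^ n) powr (- s)"
proof -
  have pos: "\<alpha> > 0" "1 - q ^ n > 0" "sqrt D > 0" "D > 0"
    using alpha_gt_1 q_power_bounds[OF assms(2)] D_pos by auto
  have U: "lucas_U P Q n > 0" unfolding lucas_U_eq using pos by simp
  have ln: "ln (lucas_U P Q n) = of_nat n * ln \<alpha> + ln (1 - q ^ n) - ln D / 2"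
    unfolding lucas_U_eq using pos by (simp add: ln_div ln_mult ln_realpow ln_sqrt)
  have pw: "complex_of_real x powr t = exp (t * of_real (ln x))" if "x > 0" for x t
    using that by (simp add: powr_def Ln_of_real)
  have "inverse (complex_of_real (lucas_U P Q n) powr s) =
      exp (- (s * (of_nat n * of_real (ln \<alpha>) + of_real (ln (1 - q ^ n)) - of_real (ln D) / 2)))"
    unfolding pw[OF U] ln exp_minus[symmetric] by simp
  also have "\<dots> = exp (s / 2 * of_real (ln D) + of_nat n * (- s * of_real (ln \<alpha>))
      + - s * of_real (ln (1 - q ^ n)))"
    by (simp add: algebra_simps)
  also have "\<dots> = complex_of_real D powr (s / 2) * exp (- s * of_real (ln \<alpha>)) ^ n
      * complex_of_real (1 - q ^ n) powr (- s)"
    unfolding pw[OF pos(2)] pw[OF pos(4)] exp_add exp_of_nat_mult ..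
  finally have "inverse (complex_of_real (lucas_U P Q n) powr s) = \<dots>" .
  then show ?thesis
    unfolding divide_inverse[of _ "complex_of_real (lucas_U P Q n) powr s"] character_power[OF assms(1)] weight_def power_mult_distrib
    by (simp only: mult_ac)
qed

lemma lucas_L_term_eq:
  assumes "e \<le> N" "n \<in> increasing_tuples e"
  shows "lucas_L_term P Q e f s n = disc_factor e s * (\<Prod>i=1..e. weight i (s i) ^ n i)
    * (\<Prod>i=1..e. complex_of_real (1 - q ^ n i) powr (- s i))"
proof -
  have "lucas_L_term P Q e f s n = (\<Prod>i=1..e. complex_of_real D powr (s i / 2) * weight i (s i) ^ n i
      * complex_of_real (1 - q ^ n i) powr (- s i))"
    unfolding lucas_L_term_def
    by (intro prod.cong refl lucas_factor_eq) (use assms in \<open>auto simp: increasing_tuples_def\<close>)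
  then show ?thesis by (simp only: disc_factor_def prod.distrib)
qed

lemma tail_weight_mult_q_power:
  "tail_weight e s i * of_real q ^ tail_sum e \<kappa> i = (\<Prod>j=i..e. weight j (s j) * of_real q ^ \<kappa> j)"
  unfolding tail_weight_def tail_sum_def power_sum prod.distrib ..

text \<open>The tail sum contains \<open>\<kappa> i\<close>. Passing to this weaker power decouples
  the coordinates, so that majorants become products of one-variable terms.\<close>

lemma q_power_tail_sum_le: "i \<in> {1..e} \<Longrightarrow> \<bar>q\<bar> ^ tail_sum e \<kappa> i \<le> \<bar>q\<bar> ^ \<kappa> i"
  using abs_q_less_1 by (intro power_decreasing) (auto simp: tail_sum_def intro: member_le_sum)

lemma summable_coef_power:
  "0 \<le> M \<Longrightarrow> (\<lambda>k. pochhammer M k / fact k * \<bar>q\<bar> ^ k) summable_on UNIV"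
  using summable_pochhammer_power[of "\<bar>q\<bar>" M] abs_q_less_1
  by (subst summable_on_UNIV_nonneg_real_iff) (auto intro!: mult_nonneg_nonneg divide_nonneg_nonneg pochhammer_real_nonneg)

text \<open>A double series over pairs of a tuple \<open>n\<close> and a multi-index
  \<open>\<kappa>\<close> is summed in both orders: over \<open>\<kappa>\<close> first it gives the
  terms of the L-series, over \<open>n\<close> first the terms of \<open>G\<close>.\<close>

lemma has_sum_lucas_L:
  assumes e: "e \<le> N" and c: "\<And>i. i \<in> {1..e} \<Longrightarrow> norm (tail_weight e s i) < 1"
  shows "(\<lambda>n. norm (lucas_L_term P Q e f s n)) summable_on increasing_tuples e"
    and "(\<Sum>\<^sub>\<infinity>n\<in>increasing_tuples e. lucas_L_term P Q e f s n) = G e s"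
proof -
  let ?I = "increasing_tuples e" and ?N = "{1..e} \<rightarrow>\<^sub>E (UNIV :: nat set)"
  let ?z = "\<lambda>\<kappa> i. tail_weight e s i * of_real q ^ tail_sum e \<kappa> i"
  define C where "C \<kappa> = (\<Prod>i=1..e. coef (s i) (\<kappa> i))" for \<kappa>
  define Y where "Y \<kappa> n = (\<Prod>i=1..e. (weight i (s i) * of_real q ^ \<kappa> i) ^ n i)" for \<kappa> n :: "nat \<Rightarrow> nat"
  define T where "T = (\<lambda>(n, \<kappa>). C \<kappa> * Y \<kappa> n)"
  have z_le: "norm (?z \<kappa> i) \<le> norm (tail_weight e s i) * \<bar>q\<bar> ^ \<kappa> i" if "i \<in> {1..e}" for \<kappa> i
    using q_power_tail_sum_le[OF that, of \<kappa>] by (simp add: norm_mult norm_power mult_left_mono)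
  have z_less: "norm (?z \<kappa> i) \<le> norm (tail_weight e s i)" if "i \<in> {1..e}" for \<kappa> i
  proof -
    have "norm (tail_weight e s i) * \<bar>q\<bar> ^ \<kappa> i \<le> norm (tail_weight e s i) * 1"
      using abs_q_less_1 by (intro mult_left_mono power_le_one) auto
    then show ?thesis using z_le[OF that, of \<kappa>] by linarith
  qed
  have prod_less: "norm (\<Prod>j=i..e. weight j (s j) * of_real q ^ \<kappa> j) < 1" if "i \<in> {1..e}" for i \<kappa>
    using z_less[OF that, of \<kappa>] c[OF that] by (simp only: tail_weight_mult_q_power)
  have Y_sum: "(Y \<kappa> has_sum (\<Prod>i=1..e. ?z \<kappa> i / (1 - ?z \<kappa> i))) ?I" for \<kappa>
    unfolding Y_def tail_weight_mult_q_power using prod_less by (rule has_sum_increasing_tuples(2))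
  have Y_norm: "((\<lambda>n. norm (Y \<kappa> n)) has_sum (\<Prod>i=1..e. norm (?z \<kappa> i) / (1 - norm (?z \<kappa> i)))) ?I" for \<kappa>
    using has_sum_increasing_tuples(2)[of e "\<lambda>i. norm (weight i (s i) * of_real q ^ \<kappa> i)"] prod_less
    unfolding Y_def tail_weight_mult_q_power prod_norm[symmetric] norm_power by simp
  have T_norm: "((\<lambda>n. norm (T (n, \<kappa>))) has_sum
      norm (C \<kappa>) * (\<Prod>i=1..e. norm (?z \<kappa> i) / (1 - norm (?z \<kappa> i)))) ?I" for \<kappa>
    using has_sum_cmult_right[OF Y_norm] by (simp add: T_def norm_mult)
  \<comment> \<open>Absolute convergence is checked with \<open>\<kappa>\<close> outside, because
    the inner sum of norms over \<open>n\<close> is an explicit geometric one.\<close>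
  have "(\<lambda>(\<kappa>, n). norm (T (n, \<kappa>))) summable_on (?N \<times> ?I)"
  proof (rule summable_on_SigmaI)
    fix \<kappa> assume "\<kappa> \<in> ?N"
    show "((\<lambda>n. case (\<kappa>, n) of (\<kappa>, n) \<Rightarrow> norm (T (n, \<kappa>))) has_sum
      norm (C \<kappa>) * (\<Prod>i=1..e. norm (?z \<kappa> i) / (1 - norm (?z \<kappa> i)))) ?I"
      using T_norm by simp
  next
    define M where "M i = norm (s i)" for i
    \<comment> \<open>The majorant is a product over \<open>i\<close> of terms depending on
      \<open>\<kappa> i\<close> alone, hence a product of convergent series.\<close>
    have "(\<lambda>\<kappa>. norm (\<Prod>i=1..e. pochhammer (M i) (\<kappa> i) / fact (\<kappa> i) * \<bar>q\<bar> ^ \<kappa> i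
        * (norm (tail_weight e s i) / (1 - norm (tail_weight e s i))))) summable_on ?N" (is "?b summable_on _")
    proof (rule has_sum_prod_PiE(1))
      fix i
      have "(\<lambda>k. pochhammer (M i) k / fact k * \<bar>q\<bar> ^ k) summable_on UNIV"
        by (rule summable_coef_power) (simp add: M_def)
      then have *: "(\<lambda>k. pochhammer (M i) k / fact k * \<bar>q\<bar> ^ k
          * (norm (tail_weight e s i) / (1 - norm (tail_weight e s i)))) summable_on UNIV"
        by (rule summable_on_cmult_left)
      then show "(\<lambda>k. norm (pochhammer (M i) k / fact k * \<bar>q\<bar> ^ k
          * (norm (tail_weight e s i) / (1 - norm (tail_weight e s i))))) summable_on UNIV"
        by (simp only: summable_on_iff_abs_summable_on_real[symmetric])
      from has_sum_infsum[OF *]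
      show "((\<lambda>k. pochhammer (M i) k / fact k * \<bar>q\<bar> ^ k
          * (norm (tail_weight e s i) / (1 - norm (tail_weight e s i)))) has_sum (\<Sum>\<^sub>\<infinity>k. pochhammer (M i) k / fact k * \<bar>q\<bar> ^ k
          * (norm (tail_weight e s i) / (1 - norm (tail_weight e s i))))) UNIV" .
    qed simp
    then show "(\<lambda>\<kappa>. norm (C \<kappa>) * (\<Prod>i=1..e. norm (?z \<kappa> i) / (1 - norm (?z \<kappa> i)))) summable_on ?N"
    proof (rule summable_on_comparison_test)
      fix \<kappa> assume "\<kappa> \<in> ?N"
      have "norm (C \<kappa>) * (\<Prod>i=1..e. norm (?z \<kappa> i) / (1 - norm (?z \<kappa> i))) =
         (\<Prod>i=1..e. norm (coef (s i) (\<kappa> i)) * (norm (?z \<kappa> i) / (1 - norm (?z \<kappa> i))))"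
        unfolding C_def prod_norm[symmetric] prod.distrib ..
      also have "\<dots> \<le> (\<Prod>i=1..e. pochhammer (M i) (\<kappa> i) / fact (\<kappa> i) * \<bar>q\<bar> ^ \<kappa> i
        * (norm (tail_weight e s i) / (1 - norm (tail_weight e s i))))"
      proof (intro prod_mono conjI)
        fix i assume i: "i \<in> {1..e}"
        have "norm (?z \<kappa> i) / (1 - norm (?z \<kappa> i)) \<le> norm (tail_weight e s i) * \<bar>q\<bar> ^ \<kappa> i / (1 - norm (tail_weight e s i))"
          by (rule frac_le) (use z_le[OF i, of \<kappa>] z_less[OF i, of \<kappa>] c[OF i] in auto)
        moreover have "norm (coef (s i) (\<kappa> i)) \<le> pochhammer (M i) (\<kappa> i) / fact (\<kappa> i)"
          unfolding coef_def M_def by (rule norm_pochhammer_le) simp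
        ultimately have "norm (coef (s i) (\<kappa> i)) * (norm (?z \<kappa> i) / (1 - norm (?z \<kappa> i)))
            \<le> pochhammer (M i) (\<kappa> i) / fact (\<kappa> i) * (norm (tail_weight e s i) * \<bar>q\<bar> ^ \<kappa> i / (1 - norm (tail_weight e s i)))"
          using c[OF i] z_less[OF i, of \<kappa>]
          by (intro mult_mono) (auto simp: M_def intro!: divide_nonneg_nonneg pochhammer_real_nonneg)
        then show "norm (coef (s i) (\<kappa> i)) * (norm (?z \<kappa> i) / (1 - norm (?z \<kappa> i))) \<le>
           pochhammer (M i) (\<kappa> i) / fact (\<kappa> i) * \<bar>q\<bar> ^ \<kappa> i * (norm (tail_weight e s i) / (1 - norm (tail_weight e s i)))"
          by (simp add: mult_ac)
        show "0 \<le> norm (coef (s i) (\<kappa> i)) * (norm (?z \<kappa> i) / (1 - norm (?z \<kappa> i)))"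
          using c[OF i] z_less[OF i, of \<kappa>] by (intro mult_nonneg_nonneg divide_nonneg_nonneg) auto
      qed
      also have "\<dots> \<le> ?b \<kappa>" by (simp only: real_norm_def abs_ge_self)
      finally show "norm (C \<kappa>) * (\<Prod>i=1..e. norm (?z \<kappa> i) / (1 - norm (?z \<kappa> i))) \<le> ?b \<kappa>" .
      show "0 \<le> norm (C \<kappa>) * (\<Prod>i=1..e. norm (?z \<kappa> i) / (1 - norm (?z \<kappa> i)))"
      proof (intro mult_nonneg_nonneg prod_nonneg divide_nonneg_nonneg ballI norm_ge_zero)
        fix i assume i: "i \<in> {1..e}"
        show "0 \<le> 1 - norm (?z \<kappa> i)" using c[OF i] z_less[OF i, of \<kappa>] by linarith
      qed
    qed
  qed auto
  then have T_abs: "(\<lambda>x. norm (T x)) summable_on (?I \<times> ?N)"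
    by (subst summable_on_swap) (simp add: case_prod_unfold)
  then have T_sum: "T summable_on (?I \<times> ?N)" by (rule abs_summable_summable)
  \<comment> \<open>The other order: for fixed \<open>n\<close> the sum over \<open>\<kappa>\<close>
    is a product of binomial series.\<close>
  have inner: "((\<lambda>\<kappa>. T (n, \<kappa>)) has_sum (\<Prod>i=1..e. weight i (s i) ^ n i)
      * (\<Prod>i=1..e. complex_of_real (1 - q ^ n i) powr (- s i))) ?N" if n: "n \<in> ?I" for n
  proof -
    have "norm (complex_of_real q ^ n i) < 1" if "i \<in> {1..e}" for i
      using n that abs_q_less_1 unfolding increasing_tuples_def
      by (auto simp: norm_power power_less_one_iff)
    then have *: "((\<lambda>\<kappa>. \<Prod>i=1..e. pochhammer (s i) (\<kappa> i) / fact (\<kappa> i) * (complex_of_real q ^ n i) ^ \<kappa> i)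
        has_sum (\<Prod>i=1..e. (1 - complex_of_real q ^ n i) powr (- s i))) ?N"
      by (intro has_sum_prod_PiE(2) has_sum_pochhammer_power) auto
    have "(\<Prod>i=1..e. weight i (s i) ^ n i) * (\<Prod>i=1..e. pochhammer (s i) (\<kappa> i) / fact (\<kappa> i) * (complex_of_real q ^ n i) ^ \<kappa> i)
      = T (n, \<kappa>)" for \<kappa>
      unfolding T_def C_def Y_def coef_def prod.distrib power_mult_distrib prod.case
      by (simp only: power_mult[symmetric] mult_ac)
    with has_sum_cmult_right[OF *, of "\<Prod>i=1..e. weight i (s i) ^ n i"] show ?thesis by simp
  qed
  have term_eq: "lucas_L_term P Q e f s n = disc_factor e s * (\<Sum>\<^sub>\<infinity>\<kappa>\<in>?N. T (n, \<kappa>))" if "n \<in> ?I" for n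
    unfolding infsumI[OF inner[OF that]] lucas_L_term_eq[OF e that] by (rule mult.assoc)
  have 1: "\<forall>n\<in>?I. (\<lambda>\<kappa>. norm (T (n, \<kappa>))) summable_on ?N"
    "(\<lambda>n. norm (\<Sum>\<^sub>\<infinity>\<kappa>\<in>?N. norm (T (n, \<kappa>)))) summable_on ?I"
    using T_abs[unfolded Infinite_Sum.abs_summable_on_Sigma_iff] by blast+
  have "(\<lambda>n. norm (disc_factor e s * (\<Sum>\<^sub>\<infinity>\<kappa>\<in>?N. T (n, \<kappa>)))) summable_on ?I"
  proof (rule summable_on_comparison_test)
    show "(\<lambda>n. norm (disc_factor e s) * norm (\<Sum>\<^sub>\<infinity>\<kappa>\<in>?N. norm (T (n, \<kappa>)))) summable_on ?I"
      by (rule summable_on_cmult_right[OF 1(2)])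
    fix n assume "n \<in> ?I"
    then have "norm (\<Sum>\<^sub>\<infinity>\<kappa>\<in>?N. T (n, \<kappa>)) \<le> (\<Sum>\<^sub>\<infinity>\<kappa>\<in>?N. norm (T (n, \<kappa>)))"
      using 1(1) by (intro norm_infsum_bound) auto
    also have "\<dots> \<le> norm (\<Sum>\<^sub>\<infinity>\<kappa>\<in>?N. norm (T (n, \<kappa>)))" by simp
    finally show "norm (disc_factor e s * (\<Sum>\<^sub>\<infinity>\<kappa>\<in>?N. T (n, \<kappa>))) \<le>
        norm (disc_factor e s) * norm (\<Sum>\<^sub>\<infinity>\<kappa>\<in>?N. norm (T (n, \<kappa>)))"
      unfolding norm_mult by (rule mult_left_mono) simp
  qed auto
  then show "(\<lambda>n. norm (lucas_L_term P Q e f s n)) summable_on ?I"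
    by (subst summable_on_cong[OF arg_cong[where f = norm, OF term_eq]])
  have "(\<Sum>\<^sub>\<infinity>n\<in>?I. lucas_L_term P Q e f s n) = disc_factor e s * (\<Sum>\<^sub>\<infinity>n\<in>?I. \<Sum>\<^sub>\<infinity>\<kappa>\<in>?N. T (n, \<kappa>))"
    by (simp only: term_eq infsum_cmult_right' cong: infsum_cong)
  also have "(\<Sum>\<^sub>\<infinity>n\<in>?I. \<Sum>\<^sub>\<infinity>\<kappa>\<in>?N. T (n, \<kappa>)) = (\<Sum>\<^sub>\<infinity>\<kappa>\<in>?N. \<Sum>\<^sub>\<infinity>n\<in>?I. T (n, \<kappa>))"
    by (rule infsum_swap_banach) (use T_sum in simp)
  finally have *: "(\<Sum>\<^sub>\<infinity>n\<in>?I. lucas_L_term P Q e f s n) =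
    disc_factor e s * (\<Sum>\<^sub>\<infinity>\<kappa>\<in>?N. \<Sum>\<^sub>\<infinity>n\<in>?I. T (n, \<kappa>))" .
  have "(\<Sum>\<^sub>\<infinity>n\<in>?I. T (n, \<kappa>)) = G_term e s \<kappa>" for \<kappa>
    using has_sum_cmult_right[OF Y_sum, of "C \<kappa>" \<kappa>] unfolding G_term_def C_def[symmetric] T_def
    by (simp add: infsumI)
  with * show "(\<Sum>\<^sub>\<infinity>n\<in>?I. lucas_L_term P Q e f s n) = G e s"
    by (simp only: G_def)
qed

text \<open>Necessity is seen on the tuples \<open>(1, \<dots>, i - 1, i + m, \<dots>, e + m)\<close>, \<open>m \<ge> 0\<close>.\<close>

lemma lucas_L_region_iff:
  assumes e: "e \<le> N"
  shows "s \<in> lucas_L_region P Q e f \<longleftrightarrow> s \<in> cspace e \<and> (\<forall>i\<in>{1..e}. norm (tail_weight e s i) < 1)"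
proof
  assume "s \<in> cspace e \<and> (\<forall>i\<in>{1..e}. norm (tail_weight e s i) < 1)"
  then show "s \<in> lucas_L_region P Q e f"
    using has_sum_lucas_L(1)[OF e, of s] by (simp add: lucas_L_region_def)
next
  assume "s \<in> lucas_L_region P Q e f"
  then have s: "s \<in> cspace e"
    and sm: "(\<lambda>n. norm (lucas_L_term P Q e f s n)) summable_on increasing_tuples e"
    by (auto simp: lucas_L_region_def)
  have "norm (tail_weight e s i) < 1" if i: "i \<in> {1..e}" for i
  proof -
    define t where "t m = (\<lambda>j\<in>{1..e}. if j < i then j else j + m)" for m :: nat
    have t: "t m \<in> increasing_tuples e" for m
      by (auto simp: increasing_tuples_def strict_mono_on_def t_def)
    have inj: "inj t"
    proof (rule injI)
      fix m m' assume "t m = t m'"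
      then have "t m i = t m' i" by simp
      then show "m = m'" using i by (simp add: t_def)
    qed
    have "(\<lambda>n. norm (lucas_L_term P Q e f s n)) summable_on range t"
      by (rule summable_on_subset_banach[OF sm]) (use t in auto)
    then have "(\<lambda>m. norm (lucas_L_term P Q e f s (t m))) summable_on UNIV"
      by (subst (asm) summable_on_reindex[OF inj]) (simp add: o_def)
    then have sm': "summable (\<lambda>m. norm (lucas_L_term P Q e f s (t m)))"
      by (rule summable_on_imp_summable)
    \<comment> \<open>The part of the lower bound independent of \<open>m\<close>: the terms for the
      starting tuple with entries \<open>j\<close>, and uniform lower bounds for the powers of
      \<open>1 - q ^ t m j\<close>.\<close>
    define \<gamma> where "\<gamma> = norm (disc_factor e s) * (\<Prod>j=1..e. norm (weight j (s j)) ^ j)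
      * (\<Prod>j=1..e. exp (- (norm (- s j) * (\<bar>ln (1 - \<bar>q\<bar>)\<bar> + ln 2))))"
    have anz: "weight j (s j) \<noteq> 0" if "j \<in> {1..e}" for j using weight_nz that e by auto
    have "\<gamma> > 0" unfolding \<gamma>_def
      using D_pos anz by (intro mult_pos_pos prod_pos) (auto simp: disc_factor_def)
    have ge: "\<gamma> * norm (tail_weight e s i) ^ m \<le> norm (lucas_L_term P Q e f s (t m))" for m
    proof -
      \<comment> \<open>The shift by \<open>m\<close> affects exactly the entries from
        \<open>i\<close> on and contributes the \<open>m\<close>-th power of the tail
        weight.\<close>
      have "(\<Prod>j=1..e. weight j (s j) ^ t m j) =
          (\<Prod>j=1..e. weight j (s j) ^ j) * (\<Prod>j=1..e. if j < i then 1 else weight j (s j) ^ m)"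
        unfolding prod.distrib[symmetric] by (intro prod.cong) (auto simp: t_def power_add)
      also have "(\<Prod>j=1..e. if j < i then 1 else weight j (s j) ^ m) = (\<Prod>j=i..e. weight j (s j) ^ m)"
        by (rule prod.mono_neutral_cong_right) (use i in auto)
      also have "\<dots> = tail_weight e s i ^ m" by (simp add: tail_weight_def prod_power_distrib)
      finally have A: "(\<Prod>j=1..e. weight j (s j) ^ t m j) = (\<Prod>j=1..e. weight j (s j) ^ j) * tail_weight e s i ^ m" .
      have "(\<Prod>j=1..e. exp (- (norm (- s j) * (\<bar>ln (1 - \<bar>q\<bar>)\<bar> + ln 2))))
        \<le> norm (\<Prod>j=1..e. complex_of_real (1 - q ^ t m j) powr (- s j))"
        unfolding prod_norm[symmetric]
      proof (intro prod_mono conjI norm_powr_ge)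
        fix j assume "j \<in> {1..e}"
        then have "t m j > 0" by (simp add: t_def)
        from q_power_bounds[OF this]
        show "1 - \<bar>q\<bar> \<le> 1 - q ^ t m j" "1 - q ^ t m j \<le> 2" by auto
      qed (use abs_q_less_1 in auto)
      then have "norm (disc_factor e s) * norm ((\<Prod>j=1..e. weight j (s j) ^ j) * tail_weight e s i ^ m)
          * (\<Prod>j=1..e. exp (- (norm (- s j) * (\<bar>ln (1 - \<bar>q\<bar>)\<bar> + ln 2))))
        \<le> norm (disc_factor e s) * norm ((\<Prod>j=1..e. weight j (s j) ^ j) * tail_weight e s i ^ m)
          * norm (\<Prod>j=1..e. complex_of_real (1 - q ^ t m j) powr (- s j))"
        by (intro mult_left_mono) auto
      also have "\<dots> = norm (lucas_L_term P Q e f s (t m))"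
        unfolding lucas_L_term_eq[OF e t] A norm_mult ..
      finally show ?thesis
        by (simp add: \<gamma>_def norm_mult norm_power prod_norm[symmetric] mult_ac)
    qed
    have "summable (\<lambda>m. \<gamma> * norm (tail_weight e s i) ^ m)"
      by (rule summable_comparison_test'[OF sm', of 0]) (use ge \<open>\<gamma> > 0\<close> in auto)
    then have "summable (\<lambda>m. norm (tail_weight e s i) ^ m)"
      using \<open>\<gamma> > 0\<close> by (subst (asm) summable_cmult_iff) auto
    then show ?thesis by (simp add: summable_geometric_iff)
  qed
  with s show "s \<in> cspace e \<and> (\<forall>i\<in>{1..e}. norm (tail_weight e s i) < 1)" by blast
qed

end


context lucas_characters
begin

subsection \<open>Meromorphic continuation\<close>

text \<open>Locally only the factors \<open>1 - x q\<^sup>k\<close> with \<open>k < K0\<close> vanish; \<open>psi\<close> is the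
  corresponding common denominator and \<open>phi\<close> the numerator of \<open>x q\<^sup>k / (1 - x q\<^sup>k)\<close> over it.\<close>

definition psi :: "nat \<Rightarrow> complex \<Rightarrow> complex" where
  "psi K0 x = (\<Prod>k<K0. 1 - x * of_real q ^ k)"

definition phi :: "nat \<Rightarrow> nat \<Rightarrow> complex \<Rightarrow> complex" where
  "phi K0 k x = x * of_real q ^ k * (\<Prod>k'\<in>{..<K0} - {k}. 1 - x * of_real q ^ k')
     / (if k < K0 then 1 else 1 - x * of_real q ^ k)"

lemma psi_mult:
  assumes "psi K0 x \<noteq> 0"
  shows "psi K0 x * (x * of_real q ^ k / (1 - x * of_real q ^ k)) = phi K0 k x"
proof (cases "k < K0")
  case True
  then have *: "psi K0 x = (1 - x * of_real q ^ k) * (\<Prod>k'\<in>{..<K0} - {k}. 1 - x * of_real q ^ k')"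
    unfolding psi_def by (intro prod.remove) auto
  with assms have "1 - x * of_real q ^ k \<noteq> 0" by auto
  then show ?thesis using True by (simp add: phi_def *)
next
  case False
  then have "{..<K0} - {k} = {..<K0}" by auto
  with False show ?thesis by (simp add: phi_def psi_def)
qed

lemma norm_mult_q_power_le:
  fixes x :: complex
  assumes "norm x \<le> C" "C * \<bar>q\<bar> ^ K0 \<le> 1 / 2" "K0 \<le> k"
  shows "norm (x * of_real q ^ k) \<le> 1 / 2"
proof -
  have "C \<ge> 0" using assms(1) norm_ge_zero[of x] by linarith
  then have "norm (x * of_real q ^ k) \<le> C * \<bar>q\<bar> ^ K0"
    unfolding norm_mult norm_power
    by (intro mult_mono) (use assms abs_q_less_1 in \<open>auto intro!: power_decreasing\<close>)
  then show ?thesis using assms(2) by linarith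
qed

text \<open>The finite product is at most \<open>(1 + C) ^ K0\<close>, and a remaining denominator
  has modulus at least 1/2 by the choice of \<open>K0\<close>. The decay in \<open>k\<close> is
  uniform in \<open>x\<close>.\<close>

lemma norm_phi_le:
  fixes x :: complex
  assumes x: "norm x \<le> C" and C: "C * \<bar>q\<bar> ^ K0 \<le> 1 / 2"
  shows "norm (phi K0 k x) \<le> 2 * C * (1 + C) ^ K0 * \<bar>q\<bar> ^ k"
proof -
  have C0: "C \<ge> 0" using x norm_ge_zero[of x] by linarith
  have "norm (\<Prod>k'\<in>{..<K0} - {k}. 1 - x * of_real q ^ k') \<le> (\<Prod>k'\<in>{..<K0} - {k}. 1 + C)"
    unfolding prod_norm[symmetric]
  proof (intro prod_mono conjI norm_ge_zero)
    fix k'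
    have "norm (x * of_real q ^ k') \<le> C * 1"
      unfolding norm_mult norm_power by (intro mult_mono power_le_one)
        (use x C0 abs_q_less_1 in auto)
    then show "norm (1 - x * of_real q ^ k') \<le> 1 + C"
      using norm_triangle_ineq4[of 1 "x * of_real q ^ k'"] by simp
  qed
  also have "\<dots> = (1 + C) ^ card ({..<K0} - {k})" by simp
  also have "\<dots> \<le> (1 + C) ^ K0"
    using C0 card_mono[of "{..<K0}" "{..<K0} - {k}"] by (intro power_increasing) auto
  finally have A: "norm (\<Prod>k'\<in>{..<K0} - {k}. 1 - x * of_real q ^ k') \<le> (1 + C) ^ K0" .
  have B: "norm (if k < K0 then 1 else 1 - x * of_real q ^ k) \<ge> 1 / 2"
  proof (cases "k < K0")
    case False
    then have "norm (x * of_real q ^ k) \<le> 1 / 2" using norm_mult_q_power_le[OF x C] by simp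
    then show ?thesis using norm_triangle_ineq2[of 1 "x * of_real q ^ k"] False by simp
  qed simp
  have "norm (phi K0 k x) \<le> (C * \<bar>q\<bar> ^ k * (1 + C) ^ K0) / (1 / 2)"
    unfolding phi_def norm_divide
    by (rule frac_le[OF _ _ _ B])
       (use x A C0 in \<open>auto simp: norm_mult norm_power intro!: mult_mono\<close>)
  then show ?thesis by (simp add: mult_ac)
qed

lemma holomorphic_psi: "psi K0 holomorphic_on S"
  unfolding psi_def by (intro holomorphic_intros)

lemma holomorphic_phi:
  assumes "C * \<bar>q\<bar> ^ K0 \<le> 1 / 2"
  shows "phi K0 k holomorphic_on {x. norm x \<le> C}"
proof -
  have "1 - x * of_real q ^ k \<noteq> 0" if "norm x \<le> C" "\<not> k < K0" for x :: complex
    using norm_mult_q_power_le[OF that(1) assms, of k] that(2) by force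
  then show ?thesis
    unfolding phi_def by (cases "k < K0") (auto intro!: holomorphic_intros)
qed

text \<open>Clearing denominators term by term: for \<open>K0\<close> large enough on a given
  polydisc, this series converges there even at the poles of \<open>G\<close>.\<close>

definition G_num :: "nat \<Rightarrow> nat \<Rightarrow> (nat \<Rightarrow> complex) \<Rightarrow> complex" where
  "G_num K0 e s = disc_factor e s * (\<Sum>\<^sub>\<infinity>\<kappa>\<in>{1..e} \<rightarrow>\<^sub>E UNIV.
     (\<Prod>i=1..e. coef (s i) (\<kappa> i)) * (\<Prod>i=1..e. phi K0 (tail_sum e \<kappa> i) (tail_weight e s i)))"

definition G_den :: "nat \<Rightarrow> nat \<Rightarrow> (nat \<Rightarrow> complex) \<Rightarrow> complex" where
  "G_den K0 e s = (\<Prod>i=1..e. psi K0 (tail_weight e s i))"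

text \<open>The denominator is cleared in each summand by \<open>psi_mult\<close>; a constant factor
  may be moved through \<open>infsum\<close> in a field without knowing convergence.\<close>

lemma G_den_mult:
  assumes "G_den K0 e s \<noteq> 0"
  shows "G_den K0 e s * G e s = G_num K0 e s"
proof -
  have nz: "psi K0 (tail_weight e s i) \<noteq> 0" if "i \<in> {1..e}" for i
    using assms that by (auto simp: G_den_def)
  have "G_den K0 e s * G_term e s \<kappa> =
      (\<Prod>i=1..e. coef (s i) (\<kappa> i)) * (\<Prod>i=1..e. phi K0 (tail_sum e \<kappa> i) (tail_weight e s i))" for \<kappa>
  proof -
    have "G_den K0 e s * (\<Prod>i=1..e. tail_weight e s i * of_real q ^ tail_sum e \<kappa> i / (1 - tail_weight e s i * of_real q ^ tail_sum e \<kappa> i))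
        = (\<Prod>i=1..e. phi K0 (tail_sum e \<kappa> i) (tail_weight e s i))"
      unfolding G_den_def prod.distrib[symmetric] by (intro prod.cong refl psi_mult nz)
    then show ?thesis unfolding G_term_def mult.left_commute[of "G_den K0 e s"] by (rule arg_cong)
  qed
  then have "G_num K0 e s = disc_factor e s * (\<Sum>\<^sub>\<infinity>\<kappa>\<in>{1..e} \<rightarrow>\<^sub>E UNIV. G_den K0 e s * G_term e s \<kappa>)"
    unfolding G_num_def by presburger
  also have "\<dots> = disc_factor e s * (G_den K0 e s * (\<Sum>\<^sub>\<infinity>\<kappa>\<in>{1..e} \<rightarrow>\<^sub>E UNIV. G_term e s \<kappa>))"
    unfolding infsum_cmult_right' ..
  finally have "G_num K0 e s = disc_factor e s * (G_den K0 e s * (\<Sum>\<^sub>\<infinity>\<kappa>\<in>{1..e} \<rightarrow>\<^sub>E UNIV. G_term e s \<kappa>))" .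
  then show ?thesis by (simp only: G_def mult_ac)
qed

lemma holomorphic_weight: "weight j holomorphic_on S"
  unfolding weight_def by (intro holomorphic_intros)

lemma mv_holomorphic_tail_weight: "mv_holomorphic_on e' (\<lambda>s. tail_weight e s i) A"
  unfolding tail_weight_def
  by (intro mv_holomorphic_prod mv_holomorphic_coordinate[where S = UNIV] holomorphic_weight) auto

lemma mv_holomorphic_G_den: "mv_holomorphic_on e' (G_den K0 e) A"
  unfolding G_den_def
  by (intro mv_holomorphic_prod mv_holomorphic_compose[OF mv_holomorphic_tail_weight holomorphic_psi[of _ UNIV]]
      UNIV_I)

lemma mv_holomorphic_disc_factor: "mv_holomorphic_on e' (disc_factor e) A"
  unfolding disc_factor_def using D_pos
  by (intro mv_holomorphic_prod mv_holomorphic_coordinate[where S = UNIV and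
        h = "\<lambda>z. complex_of_real D powr (z / 2)"]) (auto intro!: holomorphic_intros)

lemma tail_weight_bounded:
  obtains C where "C \<ge> 0" "\<And>z i. z \<in> polydisc e p r \<Longrightarrow> i \<in> {1..e} \<Longrightarrow> norm (tail_weight e z i) \<le> C"
proof
  \<comment> \<open>Each bound is raised to at least 1, so that the full product dominates the
    product over any tail.\<close>
  define B where "B j = max 1 (norm (f j 1) * exp ((norm (p j) + r) * ln \<alpha>))" for j
  show "(\<Prod>j=1..e. B j) \<ge> 0" by (intro prod_nonneg) (auto simp: B_def)
  fix z i assume z: "z \<in> polydisc e p r" and i: "i \<in> {1..e}"
  have "norm (tail_weight e z i) \<le> (\<Prod>j=i..e. B j)"
    unfolding tail_weight_def prod_norm[symmetric]
  proof (intro prod_mono conjI norm_ge_zero)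
    fix j assume j: "j \<in> {i..e}"
    have "j \<in> {1..e}" using i j by auto
    then have "norm (z j - p j) < r" using z by (simp add: polydisc_def dist_norm)
    then have "norm (z j) \<le> norm (p j) + r"
      using norm_triangle_sub[of "z j" "p j"] by linarith
    then have "- Re (z j) \<le> norm (p j) + r" using abs_Re_le_cmod[of "z j"] by linarith
    then have "- Re (z j) * ln \<alpha> \<le> (norm (p j) + r) * ln \<alpha>"
      using ln_alpha_pos by (intro mult_right_mono) auto
    then have "norm (weight j (z j)) \<le> norm (f j 1) * exp ((norm (p j) + r) * ln \<alpha>)"
      unfolding weight_def norm_mult norm_exp_eq_Re by (intro mult_left_mono) auto
    then show "norm (weight j (z j)) \<le> B j" by (simp add: B_def)
  qed
  also have "\<dots> \<le> (\<Prod>j=1..e. B j)"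
    by (rule prod_mono2) (use i in \<open>auto simp: B_def\<close>)
  finally show "norm (tail_weight e z i) \<le> (\<Prod>j=1..e. B j)" .
qed

text \<open>The cutoff must also exceed a prescribed \<open>k\<close>, so that the factor
  responsible for the residue is among those collected in \<open>psi\<close>.\<close>

lemma ex_cutoff:
  assumes "C \<ge> 0"
  obtains K0 where "k < K0" "C * \<bar>q\<bar> ^ K0 \<le> 1 / 2"
proof -
  have "(\<lambda>n. C * \<bar>q\<bar> ^ n) \<longlonglongrightarrow> C * 0"
    using abs_q_less_1 by (intro tendsto_mult_left LIMSEQ_power_zero) simp
  then have "\<forall>\<^sub>F n in sequentially. C * \<bar>q\<bar> ^ n < 1 / 2"
    by (rule order_tendstoD) simp
  then have "\<forall>\<^sub>F n in sequentially. k < n \<and> C * \<bar>q\<bar> ^ n < 1 / 2"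
    using eventually_gt_at_top[of k] by (rule eventually_conj[rotated])
  then show ?thesis using that eventually_happens'[OF sequentially_bot]
    by (metis (mono_tags, lifting) less_imp_le)
qed

lemma mv_holomorphic_G_num:
  assumes r: "r > 0" and C: "C * \<bar>q\<bar> ^ K0 \<le> 1 / 2"
    and c_le: "\<And>z i. z \<in> polydisc e p r \<Longrightarrow> i \<in> {1..e} \<Longrightarrow> norm (tail_weight e z i) \<le> C"
  shows "mv_holomorphic_on e (G_num K0 e) (polydisc e p r)"
proof -
  \<comment> \<open>The first factor bounds the coefficients on the whole polydisc; the power of
    \<open>q\<close> and the constant come from \<open>norm_phi_le\<close>.\<close>
  define b where "b i k = pochhammer (norm (p i) + r) k / fact k * \<bar>q\<bar> ^ k * (2 * C * (1 + C) ^ K0)"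
    for i k
  have b_sum: "b i summable_on UNIV" for i
    unfolding b_def using r by (intro summable_on_cmult_left summable_coef_power) auto
  have "mv_holomorphic_on e (\<lambda>s. \<Sum>\<^sub>\<infinity>\<kappa>\<in>{1..e} \<rightarrow>\<^sub>E UNIV.
     (\<Prod>i=1..e. coef (s i) (\<kappa> i)) * (\<Prod>i=1..e. phi K0 (tail_sum e \<kappa> i) (tail_weight e s i))) (polydisc e p r)"
  proof (rule mv_holomorphic_infsum)
    show "(\<lambda>\<kappa>. norm (\<Prod>i=1..e. b i (\<kappa> i))) summable_on {1..e} \<rightarrow>\<^sub>E UNIV"
    proof (rule has_sum_prod_PiE(1))
      fix i
      show "(b i has_sum (infsum (b i) UNIV)) UNIV" using b_sum by simp
      show "(\<lambda>y. norm (b i y)) summable_on UNIV"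
        using b_sum by (simp only: summable_on_iff_abs_summable_on_real[symmetric])
    qed simp
  next
    fix \<kappa> :: "nat \<Rightarrow> nat"
    show "mv_holomorphic_on e (\<lambda>s. (\<Prod>i=1..e. coef (s i) (\<kappa> i)) *
        (\<Prod>i=1..e. phi K0 (tail_sum e \<kappa> i) (tail_weight e s i))) (polydisc e p r)"
    proof (intro mv_holomorphic_mult mv_holomorphic_prod)
      fix i assume i: "i \<in> {1..e}"
      show "mv_holomorphic_on e (\<lambda>s. coef (s i) (\<kappa> i)) (polydisc e p r)"
        by (rule mv_holomorphic_coordinate[where S = UNIV and h = "\<lambda>z. coef z (\<kappa> i)"])
           (auto simp: coef_def pochhammer_prod intro!: holomorphic_intros)
      show "mv_holomorphic_on e (\<lambda>s. phi K0 (tail_sum e \<kappa> i) (tail_weight e s i)) (polydisc e p r)"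
        by (rule mv_holomorphic_compose[OF mv_holomorphic_tail_weight holomorphic_phi[OF C]])
           (use c_le i in auto)
    qed
    fix s assume s: "s \<in> polydisc e p r"
    have "norm ((\<Prod>i=1..e. coef (s i) (\<kappa> i)) * (\<Prod>i=1..e. phi K0 (tail_sum e \<kappa> i) (tail_weight e s i)))
        = (\<Prod>i=1..e. norm (coef (s i) (\<kappa> i)) * norm (phi K0 (tail_sum e \<kappa> i) (tail_weight e s i)))"
      unfolding norm_mult prod_norm[symmetric] prod.distrib ..
    also have "\<dots> \<le> (\<Prod>i=1..e. b i (\<kappa> i))"
    proof (intro prod_mono conjI mult_nonneg_nonneg norm_ge_zero)
      fix i assume i: "i \<in> {1..e}"
      have C0: "C \<ge> 0" using c_le[OF s i] norm_ge_zero order_trans by blast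
      have "norm (s i - p i) < r" using s i by (simp add: polydisc_def dist_norm)
      then have "norm (s i) \<le> norm (p i) + r"
        using norm_triangle_sub[of "s i" "p i"] by linarith
      then have 1: "norm (coef (s i) (\<kappa> i)) \<le> pochhammer (norm (p i) + r) (\<kappa> i) / fact (\<kappa> i)"
        unfolding coef_def by (rule norm_pochhammer_le)
      have "norm (phi K0 (tail_sum e \<kappa> i) (tail_weight e s i)) \<le> 2 * C * (1 + C) ^ K0 * \<bar>q\<bar> ^ tail_sum e \<kappa> i"
        by (rule norm_phi_le[OF c_le[OF s i] C])
      also have "\<dots> \<le> 2 * C * (1 + C) ^ K0 * \<bar>q\<bar> ^ \<kappa> i"
        using C0 q_power_tail_sum_le[OF i] by (intro mult_left_mono) auto
      finally have "norm (coef (s i) (\<kappa> i)) * norm (phi K0 (tail_sum e \<kappa> i) (tail_weight e s i)) \<le>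
          (pochhammer (norm (p i) + r) (\<kappa> i) / fact (\<kappa> i)) * (2 * C * (1 + C) ^ K0 * \<bar>q\<bar> ^ \<kappa> i)"
        using 1 r by (intro mult_mono) (auto intro!: divide_nonneg_nonneg pochhammer_real_nonneg)
      then show "norm (coef (s i) (\<kappa> i)) * norm (phi K0 (tail_sum e \<kappa> i) (tail_weight e s i)) \<le> b i (\<kappa> i)"
        by (simp add: b_def mult_ac)
    qed
    also have "\<dots> \<le> norm (\<Prod>i=1..e. b i (\<kappa> i))" by (simp only: real_norm_def abs_ge_self)
    finally show "norm ((\<Prod>i=1..e. coef (s i) (\<kappa> i)) * (\<Prod>i=1..e. phi K0 (tail_sum e \<kappa> i) (tail_weight e s i)))
      \<le> norm (\<Prod>i=1..e. b i (\<kappa> i))" .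
  qed
  then show ?thesis
    unfolding G_num_def by (intro mv_holomorphic_mult mv_holomorphic_disc_factor)
qed

text \<open>On the real ray through \<open>p\<close> in direction \<open>(1, \<dots>, 1)\<close> every \<open>tail_weight e\<close>
  has strictly decreasing modulus.\<close>

lemma ex_tail_weight_avoiding:
  assumes e: "e \<le> N" and p: "p \<in> cspace e" and r: "r > 0" and T: "finite T"
  shows "\<exists>s\<in>polydisc e p r. \<forall>i\<in>{1..e}. tail_weight e s i \<notin> T"
proof -
  define S where "S t = (\<lambda>i\<in>{1..e}. p i + complex_of_real t)" for t :: real
  have cS: "norm (tail_weight e (S t) i) = norm (tail_weight e p i) * exp (- (t * ln \<alpha>)) ^ card {i..e}"
    if "i \<in> {1..e}" for i t
  proof -
    have "weight j (S t j) = weight j (p j) * exp (- (of_real t * of_real (ln \<alpha>)))" if "j \<in> {i..e}" for j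
      using that \<open>i \<in> {1..e}\<close> by (simp add: S_def weight_def exp_add[symmetric] algebra_simps)
    then have "tail_weight e (S t) i = tail_weight e p i * exp (- (of_real t * of_real (ln \<alpha>))) ^ card {i..e}"
      by (simp add: tail_weight_def prod.distrib)
    then show ?thesis by (simp add: norm_mult norm_power)
  qed
  have inj: "inj (\<lambda>t. tail_weight e (S t) i)" if i: "i \<in> {1..e}" for i
  proof (rule injI)
    fix t t' assume "tail_weight e (S t) i = tail_weight e (S t') i"
    then have "norm (tail_weight e p i) * exp (- (t * ln \<alpha>)) ^ card {i..e}
        = norm (tail_weight e p i) * exp (- (t' * ln \<alpha>)) ^ card {i..e}"
      using cS[OF i] by metis
    moreover have "tail_weight e p i \<noteq> 0" using i e weight_nz by (auto simp: tail_weight_def)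
    ultimately have "exp (- (t * ln \<alpha>)) ^ card {i..e} = exp (- (t' * ln \<alpha>)) ^ card {i..e}"
      by simp
    then have "exp (- (t * ln \<alpha>)) = exp (- (t' * ln \<alpha>))"
      by (rule power_eq_imp_eq_base) (use i in auto)
    then show "t = t'" using ln_alpha_pos by simp
  qed
  \<comment> \<open>By injectivity each tail weight hits \<open>T\<close> for finitely many
    \<open>t\<close> only, whereas the available interval is infinite.\<close>
  have "finite (\<Union>i\<in>{1..e}. (\<lambda>t. tail_weight e (S t) i) -` T)"
    using T inj by (intro finite_UN_I finite_vimageI) auto
  moreover have "infinite {0<..<r}" using r by simp
  ultimately obtain t where t: "t \<in> {0<..<r}" "t \<notin> (\<Union>i\<in>{1..e}. (\<lambda>t. tail_weight e (S t) i) -` T)"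
    by (meson finite_subset subsetI)
  have "S t \<in> polydisc e p r"
    using t(1) p by (auto simp: S_def polydisc_def cspace_def dist_norm)
  then show ?thesis using t(2) by blast
qed

text \<open>The zeros of \<open>psi K0\<close> are the finitely many numbers
  \<open>1 / q ^ k\<close> with \<open>k < K0\<close>, which all tail weights can avoid at
  once.\<close>

lemma ex_G_den_nonzero:
  assumes "e \<le> N" "p \<in> cspace e" "r > 0"
  shows "\<exists>s\<in>polydisc e p r. G_den K0 e s \<noteq> 0"
proof -
  obtain s where s: "s \<in> polydisc e p r"
    "\<forall>i\<in>{1..e}. tail_weight e s i \<notin> (\<lambda>k. 1 / complex_of_real q ^ k) ` {..<K0}"
    using ex_tail_weight_avoiding[OF assms, of "(\<lambda>k. 1 / complex_of_real q ^ k) ` {..<K0}"] by blast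
  have "1 - tail_weight e s i * of_real q ^ k \<noteq> 0" if "i \<in> {1..e}" "k < K0" for i k
  proof
    assume "1 - tail_weight e s i * of_real q ^ k = 0"
    then have "tail_weight e s i = 1 / of_real q ^ k" using q_nz by (simp add: field_simps)
    then show False using s(2) that by blast
  qed
  then have "G_den K0 e s \<noteq> 0" by (simp add: G_den_def psi_def)
  then show ?thesis using s(1) by blast
qed

lemma mv_meromorphic_G:
  assumes e: "e \<le> N"
  shows "mv_meromorphic e (G e)"
  unfolding mv_meromorphic_def
proof
  fix p assume p: "p \<in> cspace e"
  obtain C where C: "C \<ge> 0"
    "\<And>z i. z \<in> polydisc e p 1 \<Longrightarrow> i \<in> {1..e} \<Longrightarrow> norm (tail_weight e z i) \<le> C"
    using tail_weight_bounded[of e p 1] by blast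
  obtain K0 where K0: "C * \<bar>q\<bar> ^ K0 \<le> 1 / 2"
    using ex_cutoff[OF C(1)] by metis
  show "\<exists>r>0. \<exists>g h. mv_holomorphic_on e g (polydisc e p r) \<and>
      mv_holomorphic_on e h (polydisc e p r) \<and> (\<exists>z\<in>polydisc e p r. h z \<noteq> 0) \<and>
      generically_eq_on e (polydisc e p r) (G e) (\<lambda>z. g z / h z)"
  proof (intro exI conjI)
    show "mv_holomorphic_on e (G_num K0 e) (polydisc e p 1)"
      by (rule mv_holomorphic_G_num[OF _ K0 C(2)]) auto
    show "mv_holomorphic_on e (G_den K0 e) (polydisc e p 1)" by (rule mv_holomorphic_G_den)
    show nz: "\<exists>z\<in>polydisc e p 1. G_den K0 e z \<noteq> 0" by (rule ex_G_den_nonzero[OF e p]) simp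
    show "generically_eq_on e (polydisc e p 1) (G e) (\<lambda>z. G_num K0 e z / G_den K0 e z)"
    proof (rule generically_eq_on_nonzero[OF mv_holomorphic_G_den nz])
      fix z assume "G_den K0 e z \<noteq> 0"
      then show "G e z = G_num K0 e z / G_den K0 e z"
        using G_den_mult[of K0 e z] by (simp add: field_simps)
    qed
  qed simp
qed

lemma lucas_L_continuation_G:
  assumes "e \<le> N"
  shows "lucas_L_continuation P Q e f (G e)"
  unfolding lucas_L_continuation_def
proof (intro conjI ballI)
  fix s assume "s \<in> lucas_L_region P Q e f"
  then show "G e s = (\<Sum>\<^sub>\<infinity>n\<in>increasing_tuples e. lucas_L_term P Q e f s n)"
    using has_sum_lucas_L(2)[OF assms] lucas_L_region_iff[OF assms] by simp
qed (rule mv_meromorphic_G[OF assms])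

lemma ex_open_region:
  assumes e: "e \<le> N"
  shows "\<exists>V\<subseteq>lucas_L_region P Q e f. openin (top_of_set (cspace e)) V \<and> V \<noteq> {}"
proof (intro exI conjI)
  \<comment> \<open>The shift by 1 makes \<open>Re (z j)\<close> exceed
    \<open>ln (2 * norm (f j 1)) / ln \<alpha>\<close> on the unit polydisc, so each weight there is
    at most 1/2.\<close>
  define p where "p = (\<lambda>j\<in>{1..e}. complex_of_real (1 + ln (2 * norm (f j 1)) / ln \<alpha>))"
  show "openin (top_of_set (cspace e)) (polydisc e p 1)" by (rule openin_polydisc)
  show "polydisc e p 1 \<noteq> {}"
    using polydisc_center[of p e 1] by (auto simp: p_def cspace_def)
  show "polydisc e p 1 \<subseteq> lucas_L_region P Q e f"
  proof
    fix z assume z: "z \<in> polydisc e p 1"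
    have a_le: "norm (weight j (z j)) \<le> 1 / 2" if j: "j \<in> {1..e}" for j
    proof -
      have fnz: "f j 1 \<noteq> 0" using j e character_nz by auto
      have "norm (z j - p j) < 1" using z j by (auto simp: polydisc_def dist_norm)
      then have "\<bar>Re (z j) - Re (p j)\<bar> < 1"
        using abs_Re_le_cmod[of "z j - p j"] by simp
      then have "ln (2 * norm (f j 1)) / ln \<alpha> < Re (z j)" using j by (auto simp: p_def)
      then have "ln (2 * norm (f j 1)) < Re (z j) * ln \<alpha>"
        using ln_alpha_pos by (simp add: field_simps)
      then have "exp (- Re (z j) * ln \<alpha>) \<le> exp (- ln (2 * norm (f j 1)))" by simp
      also have "\<dots> = 1 / (2 * norm (f j 1))" using fnz by (simp add: exp_minus inverse_eq_divide)
      finally have "norm (f j 1) * exp (- Re (z j) * ln \<alpha>) \<le> norm (f j 1) * (1 / (2 * norm (f j 1)))"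
        by (rule mult_left_mono) simp
      then show ?thesis using fnz by (simp add: weight_def norm_mult)
    qed
    have "norm (tail_weight e z i) < 1" if i: "i \<in> {1..e}" for i
    proof -
      have "norm (tail_weight e z i) = norm (weight i (z i)) * (\<Prod>j=Suc i..e. norm (weight j (z j)))"
        using i by (simp add: tail_weight_def prod.atLeast_Suc_atMost norm_mult prod_norm)
      also have "\<dots> \<le> 1 / 2 * 1"
      proof (intro mult_mono prod_le_1 conjI norm_ge_zero prod_nonneg)
        fix j assume "j \<in> {Suc i..e}"
        then have "j \<in> {1..e}" by auto
        from a_le[OF this] show "norm (weight j (z j)) \<le> 1" by linarith
      qed (use a_le i in auto)
      finally show ?thesis by simp
    qed
    then show "z \<in> lucas_L_region P Q e f"
      using z by (simp add: lucas_L_region_iff[OF e] polydisc_def)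
  qed
qed

text \<open>\<open>G\<close> witnesses that a continuation exists, so the chosen representative is
  one; both agree on an open part of the region of convergence and the uniqueness theorem
  applies.\<close>

lemma lucas_L_generically_eq:
  assumes e: "e \<le> N"
  shows "generically_eq_on e (cspace e) (lucas_L P Q e f) (G e)"
proof -
  have L: "lucas_L_continuation P Q e f (lucas_L P Q e f)"
    unfolding lucas_L_def by (rule someI[where P = "lucas_L_continuation P Q e f", OF lucas_L_continuation_G[OF e]])
  note G = lucas_L_continuation_G[OF e]
  obtain V where "V \<subseteq> lucas_L_region P Q e f" "openin (top_of_set (cspace e)) V" "V \<noteq> {}"
    using ex_open_region[OF e] by blast
  then show ?thesis
    using L G by (intro mv_meromorphic_unique[of e _ _ V])
      (auto simp: lucas_L_continuation_def)
qed

end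


context lucas_characters
begin

subsection \<open>The residue\<close>

lemma tail_weight_last: "tail_weight (Suc m) s (Suc m) = weight (Suc m) (s (Suc m))"
  by (simp add: tail_weight_def)

lemma tail_weight_restrict: "i \<in> {1..m} \<Longrightarrow> tail_weight (Suc m) (s(Suc m := b)) i = tail_weight m s i * weight (Suc m) b"
  by (simp add: tail_weight_def)

lemma tail_sum_last: "tail_sum (Suc m) \<kappa> (Suc m) = \<kappa> (Suc m)"
  by (simp add: tail_sum_def)

lemma tail_sum_update: "i \<in> {1..m} \<Longrightarrow> tail_sum (Suc m) (\<kappa>(Suc m := k)) i = tail_sum m \<kappa> i + k"
  by (simp add: tail_sum_def)

lemma disc_factor_update: "disc_factor (Suc m) (s(Suc m := b)) = disc_factor m s * complex_of_real D powr (b / 2)"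
  by (simp add: disc_factor_def)

text \<open>The vanishing \<open>k\<close>-th factor survives in every numerator except the one with
  index \<open>k\<close>. No other factor vanishes, as powers of \<open>\<bar>q\<bar>\<close> are
  distinct.\<close>

lemma phi_resonant:
  assumes x: "x * of_real q ^ k = 1" and "k < K0"
  shows "k' \<noteq> k \<Longrightarrow> phi K0 k' x = 0"
    and "phi K0 k x = (\<Prod>j\<in>{..<K0} - {k}. 1 - x * of_real q ^ j)"
    and "(\<Prod>j\<in>{..<K0} - {k}. 1 - x * of_real q ^ j) \<noteq> 0"
proof -
  show "phi K0 k' x = 0" if "k' \<noteq> k"
  proof -
    have "(\<Prod>j\<in>{..<K0} - {k'}. 1 - x * of_real q ^ j) = 0"
      by (rule prod_zero[OF _ bexI[of _ k]]) (use assms that in auto)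
    then show ?thesis by (simp add: phi_def)
  qed
  show "phi K0 k x = (\<Prod>j\<in>{..<K0} - {k}. 1 - x * of_real q ^ j)"
    using assms by (simp add: phi_def)
  have "1 - x * of_real q ^ j \<noteq> 0" if "j \<noteq> k" for j
  proof
    assume "1 - x * of_real q ^ j = 0"
    then have "x * of_real q ^ j = x * of_real q ^ k" using x by simp
    moreover have "x \<noteq> 0" using x by auto
    ultimately have "complex_of_real q ^ j = of_real q ^ k" by simp
    then have "norm (complex_of_real q ^ j) = norm (complex_of_real q ^ k)" by simp
    then have "\<bar>q\<bar> ^ j = \<bar>q\<bar> ^ k" by (simp add: norm_power)
    then show False
      using that abs_q_pos abs_q_less_1 power_inject_exp'[of "\<bar>q\<bar>" j k] by simp
  qed
  then show "(\<Prod>j\<in>{..<K0} - {k}. 1 - x * of_real q ^ j) \<noteq> 0" by simp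
qed

text \<open>On the hyperplane only multi-indices with last entry \<open>k\<close> contribute. They
  correspond to multi-indices of depth \<open>m\<close>, and the resonance condition removes the
  last coordinate from the remaining geometric ratios.\<close>

lemma G_num_restrict:
  assumes b: "weight (Suc m) b * of_real q ^ k = 1" and k: "k < K0"
    and nz: "(\<Prod>i=1..m. psi K0 (tail_weight m s i * weight (Suc m) b)) \<noteq> 0"
  shows "G_num K0 (Suc m) (s(Suc m := b)) =
    (\<Prod>i=1..m. psi K0 (tail_weight m s i * weight (Suc m) b)) *
    (\<Prod>j\<in>{..<K0} - {k}. 1 - weight (Suc m) b * of_real q ^ j) *
    (G m s * complex_of_real D powr (b / 2) * coef b k)"
proof -
  let ?d = "Suc m" and ?s = "s(Suc m := b)"
  let ?A = "\<Prod>i=1..m. psi K0 (tail_weight m s i * weight (Suc m) b)"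
  let ?B = "\<Prod>j\<in>{..<K0} - {k}. 1 - weight (Suc m) b * of_real q ^ j"
  let ?u = "\<lambda>\<kappa>. \<kappa>(?d := k)"
  let ?M = "{1..m} \<rightarrow>\<^sub>E (UNIV :: nat set)" and ?N = "{1..?d} \<rightarrow>\<^sub>E (UNIV :: nat set)"
  define t where "t \<kappa> = (\<Prod>i=1..?d. coef (?s i) (\<kappa> i)) * (\<Prod>i=1..?d. phi K0 (tail_sum ?d \<kappa> i) (tail_weight ?d ?s i))"
    for \<kappa>
  have t_alt: "t \<kappa> = (\<Prod>i=1..m. coef (s i) (\<kappa> i)) * coef b (\<kappa> ?d)
      * ((\<Prod>i=1..m. phi K0 (tail_sum ?d \<kappa> i) (tail_weight m s i * weight ?d b)) * phi K0 (\<kappa> ?d) (weight ?d b))" for \<kappa>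
  proof -
    have "(\<Prod>i=1..m. phi K0 (tail_sum ?d \<kappa> i) (tail_weight ?d ?s i)) = (\<Prod>i=1..m. phi K0 (tail_sum ?d \<kappa> i) (tail_weight m s i * weight ?d b))"
      by (intro prod.cong refl) (simp only: tail_weight_restrict)
    moreover have "(\<Prod>i=1..m. coef (?s i) (\<kappa> i)) = (\<Prod>i=1..m. coef (s i) (\<kappa> i))"
      by (intro prod.cong) auto
    ultimately show ?thesis by (simp add: t_def tail_weight_last tail_sum_last)
  qed
  have inj: "inj_on ?u ?M"
  proof (rule inj_onI)
    fix \<kappa> \<kappa>' assume *: "\<kappa> \<in> ?M" "\<kappa>' \<in> ?M" "?u \<kappa> = ?u \<kappa>'"
    have "\<kappa> ?d = undefined" "\<kappa>' ?d = undefined" using *(1,2) by (auto simp: PiE_iff extensional_def)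
    then show "\<kappa> = \<kappa>'" using *(3) by (metis fun_upd_triv fun_upd_upd)
  qed
  have zero: "t \<kappa> = 0" if \<kappa>: "\<kappa> \<in> ?N - ?u ` ?M" for \<kappa>
  proof -
    have "\<kappa> ?d \<noteq> k"
    proof
      assume "\<kappa> ?d = k"
      \<comment> \<open>Resetting the last entry to \<open>undefined\<close> gives the extensional
        multi-index of depth \<open>m\<close>.\<close>
      then have "\<kappa> = ?u (\<kappa>(?d := undefined))" by auto
      moreover have "\<kappa>(?d := undefined) \<in> ?M"
        using \<kappa> by (auto simp: PiE_iff extensional_def)
      ultimately show False using \<kappa> by blast
    qed
    then show ?thesis using phi_resonant(1)[OF b k] by (simp add: t_alt)
  qed
  have val: "t (?u \<kappa>) = ?A * ?B * coef b k * G_term m s \<kappa>" for \<kappa>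
  proof -
    have psi_nz: "psi K0 (tail_weight m s i * weight ?d b) \<noteq> 0" if "i \<in> {1..m}" for i
      using nz that by auto
    have "phi K0 (tail_sum ?d (?u \<kappa>) i) (tail_weight m s i * weight ?d b) = psi K0 (tail_weight m s i * weight ?d b) *
        (tail_weight m s i * of_real q ^ tail_sum m \<kappa> i / (1 - tail_weight m s i * of_real q ^ tail_sum m \<kappa> i))" if i: "i \<in> {1..m}" for i
    proof -
      \<comment> \<open>The last coordinate contributes \<open>weight ?d b * q ^ k\<close>, which is
        1.\<close>
      have "tail_weight m s i * weight ?d b * of_real q ^ tail_sum ?d (?u \<kappa>) i = tail_weight m s i * of_real q ^ tail_sum m \<kappa> i * (weight ?d b * of_real q ^ k)"
        by (simp add: tail_sum_update[OF i] power_add mult_ac)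
      then have "tail_weight m s i * weight ?d b * of_real q ^ tail_sum ?d (?u \<kappa>) i = tail_weight m s i * of_real q ^ tail_sum m \<kappa> i"
        by (simp only: b mult_1_right)
      with psi_mult[OF psi_nz[OF i], of "tail_sum ?d (?u \<kappa>) i"] show ?thesis by (simp only:)
    qed
    then have "(\<Prod>i=1..m. phi K0 (tail_sum ?d (?u \<kappa>) i) (tail_weight m s i * weight ?d b)) =
       ?A * (\<Prod>i=1..m. tail_weight m s i * of_real q ^ tail_sum m \<kappa> i / (1 - tail_weight m s i * of_real q ^ tail_sum m \<kappa> i))"
      unfolding prod.distrib[symmetric] by (intro prod.cong refl)
    moreover have "(\<Prod>i=1..m. coef (s i) (?u \<kappa> i)) = (\<Prod>i=1..m. coef (s i) (\<kappa> i))"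
      by (intro prod.cong) auto
    ultimately show ?thesis
      unfolding t_alt G_term_def using phi_resonant(2)[OF b k] by (simp only: fun_upd_same mult_ac)
  qed
  have "infsum t ?N = infsum t (?u ` ?M)"
  proof (rule infsum_cong_neutral)
    fix \<kappa> assume "\<kappa> \<in> ?u ` ?M - ?N"
    then show "t \<kappa> = 0" by (auto simp: PiE_iff extensional_def)
  qed (use zero in auto)
  also have "\<dots> = (\<Sum>\<^sub>\<infinity>\<kappa>\<in>?M. ?A * ?B * coef b k * G_term m s \<kappa>)"
    unfolding infsum_reindex[OF inj] o_def val ..
  also have "\<dots> = ?A * ?B * coef b k * infsum (G_term m s) ?M"
    by (rule infsum_cmult_right')
  finally have "G_num K0 ?d ?s = disc_factor m s * complex_of_real D powr (b / 2) *
      (?A * ?B * coef b k * infsum (G_term m s) ?M)"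
    unfolding G_num_def t_def disc_factor_update by (rule arg_cong)
  then show ?thesis by (simp only: G_def mult_ac)
qed

text \<open>The factor \<open>s (Suc m) - b\<close> is divided out of the common denominator. The
  quotient \<open>h\<close> is not identically zero on the hyperplane, where numerator and
  denominator can then be restricted separately.\<close>

lemma has_residue_along_lucas_L:
  assumes N: "Suc m \<le> N" and b: "weight (Suc m) b * of_real q ^ k = 1"
  shows "has_residue_along (Suc m) (lucas_L P Q (Suc m) f) b
    (\<lambda>s. lucas_L P Q m f s * complex_of_real D powr (b / 2) * coef b k * (1 / of_real (ln \<alpha>)))"
  unfolding has_residue_along_def restricts_to_hyperplane_def
proof
  let ?d = "Suc m"
  \<comment> \<open>The entire quotient of the resonant factor by \<open>w - b\<close>; its value at
    \<open>b\<close> is the derivative there, the source of \<open>1 / ln \<alpha>\<close> in the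
    residue.\<close>
  define E where "E w = (if w = b then of_real (ln \<alpha>)
    else (1 - exp (- (w - b) * of_real (ln \<alpha>))) / (w - b))" for w
  have E_holo: "E holomorphic_on UNIV"
  proof -
    let ?g = "\<lambda>w. - exp (- (w - b) * complex_of_real (ln \<alpha>))"
    have "(?g has_field_derivative of_real (ln \<alpha>)) (at b)"
      by (auto intro!: derivative_eq_intros)
    then have g': "deriv ?g b = of_real (ln \<alpha>)" by (rule DERIV_imp_deriv)
    have "(\<lambda>w. if w = b then deriv ?g b else (?g w - ?g b) / (w - b)) holomorphic_on UNIV"
      by (intro pole_lemma holomorphic_intros) auto
    then have "(\<lambda>w. if w = b then of_real (ln \<alpha>) else (?g w - ?g b) / (w - b)) holomorphic_on UNIV"
      unfolding g' .
    then show ?thesis by (rule holomorphic_transform) (simp add: E_def)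
  qed
  have E_eq: "(w - b) * E w = 1 - weight ?d w * of_real q ^ k" for w
  proof -
    have "weight ?d w = exp (- (w - b) * of_real (ln \<alpha>)) * weight ?d b"
      by (simp add: weight_def exp_add[symmetric] algebra_simps)
    then have "weight ?d w * of_real q ^ k = exp (- (w - b) * of_real (ln \<alpha>))"
      using b by (simp add: mult.assoc)
    then show ?thesis by (simp add: E_def)
  qed
  have E_b: "E b \<noteq> 0" using ln_alpha_pos by (simp add: E_def)
  fix p assume "p \<in> cspace (?d - 1)"
  then have p: "p \<in> cspace m" by simp
  let ?p = "p(?d := b)"
  have p': "?p \<in> cspace ?d" using p by (auto simp: cspace_def PiE_iff extensional_def)
  obtain C where C: "C \<ge> 0" "\<And>z i. z \<in> polydisc ?d ?p 1 \<Longrightarrow> i \<in> {1..?d} \<Longrightarrow> norm (tail_weight ?d z i) \<le> C"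
    using tail_weight_bounded[of ?d ?p 1] by blast
  obtain K0 where K0: "k < K0" "C * \<bar>q\<bar> ^ K0 \<le> 1 / 2"
    using ex_cutoff[OF C(1)] by blast
  define h where "h s = (\<Prod>i=1..m. psi K0 (tail_weight ?d s i)) *
    (\<Prod>j\<in>{..<K0} - {k}. 1 - weight ?d (s ?d) * of_real q ^ j) * E (s ?d)" for s
  have h_mult: "(s ?d - b) * h s = G_den K0 ?d s" for s
  proof -
    have "psi K0 (weight ?d (s ?d)) = (1 - weight ?d (s ?d) * of_real q ^ k) *
        (\<Prod>j\<in>{..<K0} - {k}. 1 - weight ?d (s ?d) * of_real q ^ j)"
      unfolding psi_def by (rule prod.remove) (use K0 in auto)
    then have "psi K0 (tail_weight ?d s ?d) = (s ?d - b) * E (s ?d) *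
        (\<Prod>j\<in>{..<K0} - {k}. 1 - weight ?d (s ?d) * of_real q ^ j)"
      by (simp only: tail_weight_last E_eq)
    then show ?thesis by (simp add: h_def G_den_def mult_ac)
  qed
  define A where "A s = (\<Prod>i=1..m. psi K0 (tail_weight m s i * weight ?d b))" for s
  define B where "B = (\<Prod>j\<in>{..<K0} - {k}. 1 - weight ?d b * of_real q ^ j)"
  have B: "B \<noteq> 0" unfolding B_def by (rule phi_resonant(3)[OF b K0(1)])
  have h_restrict: "h (s(?d := b)) = A s * B * E b" for s
  proof -
    have "(\<Prod>i=1..m. psi K0 (tail_weight ?d (s(?d := b)) i)) = A s"
      unfolding A_def by (intro prod.cong refl) (simp only: tail_weight_restrict)
    then show ?thesis by (simp add: h_def B_def)
  qed
  \<comment> \<open>The zeros to be avoided are those of \<open>psi K0\<close> divided by the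
    nonzero constant \<open>weight ?d b\<close>.\<close>
  have A_nz: "\<exists>s\<in>polydisc m p 1. A s \<noteq> 0"
  proof -
    have ab: "weight ?d b \<noteq> 0" using b by auto
    let ?T = "(\<lambda>j. 1 / (weight ?d b * complex_of_real q ^ j)) ` {..<K0}"
    obtain s where s: "s \<in> polydisc m p 1" "\<forall>i\<in>{1..m}. tail_weight m s i \<notin> ?T"
      using ex_tail_weight_avoiding[of m p 1 ?T] N p by auto
    have "1 - tail_weight m s i * weight ?d b * of_real q ^ j \<noteq> 0" if "i \<in> {1..m}" "j < K0" for i j
    proof
      assume "1 - tail_weight m s i * weight ?d b * of_real q ^ j = 0"
      then have "tail_weight m s i = 1 / (weight ?d b * of_real q ^ j)" using q_nz ab by (simp add: field_simps)
      then show False using s(2) that by blast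
    qed
    then have "A s \<noteq> 0" by (simp add: A_def psi_def)
    then show ?thesis using s(1) by blast
  qed
  have A_holo: "mv_holomorphic_on m A (polydisc m p 1)"
    unfolding A_def
    by (intro mv_holomorphic_prod mv_holomorphic_compose[OF _ holomorphic_psi[of _ UNIV]]
        mv_holomorphic_mult mv_holomorphic_tail_weight mv_holomorphic_const UNIV_I)
  show "\<exists>r>0. \<exists>g h.
        mv_holomorphic_on ?d g (polydisc ?d ?p r) \<and>
        mv_holomorphic_on ?d h (polydisc ?d ?p r) \<and>
        (\<exists>s\<in>polydisc (?d - 1) p r. h (s(?d := b)) \<noteq> 0) \<and>
        generically_eq_on ?d (polydisc ?d ?p r) (\<lambda>s. (s ?d - b) * lucas_L P Q ?d f s) (\<lambda>z. g z / h z) \<and>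
        generically_eq_on (?d - 1) (polydisc (?d - 1) p r)
          (\<lambda>s. lucas_L P Q m f s * complex_of_real D powr (b / 2) * coef b k * (1 / of_real (ln \<alpha>)))
          (\<lambda>s. g (s(?d := b)) / h (s(?d := b)))"
  proof (intro exI conjI)
    show "mv_holomorphic_on ?d (G_num K0 ?d) (polydisc ?d ?p 1)"
      by (rule mv_holomorphic_G_num[OF _ K0(2) C(2)]) auto
    show "mv_holomorphic_on ?d h (polydisc ?d ?p 1)"
    proof -
      have "mv_holomorphic_on ?d (\<lambda>s. E (s ?d)) (polydisc ?d ?p 1)"
        by (rule mv_holomorphic_coordinate[OF UNIV_I E_holo])
      moreover have "mv_holomorphic_on ?d (\<lambda>s. weight ?d (s ?d)) (polydisc ?d ?p 1)"
        by (rule mv_holomorphic_coordinate[OF UNIV_I holomorphic_weight])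
      ultimately show ?thesis
        unfolding h_def
        by (intro mv_holomorphic_mult mv_holomorphic_prod mv_holomorphic_diff mv_holomorphic_const
            mv_holomorphic_compose[OF mv_holomorphic_tail_weight holomorphic_psi[of _ UNIV]] UNIV_I)
    qed
    show "\<exists>s\<in>polydisc (?d - 1) p 1. h (s(?d := b)) \<noteq> 0"
      using A_nz B E_b by (simp add: h_restrict)
    show "generically_eq_on ?d (polydisc ?d ?p 1) (\<lambda>s. (s ?d - b) * lucas_L P Q ?d f s)
        (\<lambda>z. G_num K0 ?d z / h z)"
    proof (rule generically_eq_on_combine)
      show "generically_eq_on ?d (polydisc ?d ?p 1) (lucas_L P Q ?d f) (G ?d)"
        by (rule generically_eq_on_subset[OF lucas_L_generically_eq[OF N] openin_polydisc
              polydisc_subset_cspace order_refl])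
      \<comment> \<open>Points with \<open>G_den\<close> nonzero lie off the hyperplane, so
        cancelling \<open>z ?d - b\<close> is legitimate there.\<close>
      show "generically_eq_on ?d (polydisc ?d ?p 1) (\<lambda>s. (s ?d - b) * G ?d s) (\<lambda>z. G_num K0 ?d z / h z)"
      proof (rule generically_eq_on_nonzero[OF mv_holomorphic_G_den ex_G_den_nonzero[OF N p']])
        fix z assume z: "G_den K0 ?d z \<noteq> 0"
        then have "h z \<noteq> 0" using h_mult[of z] by auto
        moreover have "(z ?d - b) * h z * G ?d z = G_num K0 ?d z"
          unfolding h_mult by (rule G_den_mult[OF z])
        ultimately show "(z ?d - b) * G ?d z = G_num K0 ?d z / h z" by (simp add: field_simps)
      qed simp
    qed (simp_all add: polydisc_subset_cspace)
    show "generically_eq_on (?d - 1) (polydisc (?d - 1) p 1)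
          (\<lambda>s. lucas_L P Q m f s * complex_of_real D powr (b / 2) * coef b k * (1 / of_real (ln \<alpha>)))
          (\<lambda>s. G_num K0 ?d (s(?d := b)) / h (s(?d := b)))"
      unfolding diff_Suc_1
    proof (rule generically_eq_on_combine)
      show "generically_eq_on m (polydisc m p 1) (lucas_L P Q m f) (G m)"
        by (rule generically_eq_on_subset[OF lucas_L_generically_eq openin_polydisc
              polydisc_subset_cspace order_refl]) (use N in simp)
      show "generically_eq_on m (polydisc m p 1)
          (\<lambda>s. G m s * complex_of_real D powr (b / 2) * coef b k * (1 / of_real (ln \<alpha>)))
          (\<lambda>s. G_num K0 ?d (s(?d := b)) / h (s(?d := b)))"
      proof (rule generically_eq_on_nonzero[OF A_holo A_nz])
        fix s assume s: "A s \<noteq> 0"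
        have "G_num K0 ?d (s(?d := b)) = A s * B * (G m s * complex_of_real D powr (b / 2) * coef b k)"
          unfolding A_def B_def by (rule G_num_restrict[OF b K0(1) s[unfolded A_def]])
        then show "G m s * complex_of_real D powr (b / 2) * coef b k * (1 / of_real (ln \<alpha>))
            = G_num K0 ?d (s(?d := b)) / h (s(?d := b))"
          using s B by (simp add: h_restrict E_def)
      qed
    qed (simp_all add: polydisc_subset_cspace)
  qed simp
qed

end

section \<open>The location of the pole and the final form of the residue\<close>

theorem theorem10:
  fixes P Q :: real and d :: nat and f :: "nat \<Rightarrow> int \<Rightarrow> complex"
    and n :: int and k :: nat and logf b :: complex
  assumes "P > 0" and "Q \<noteq> 0"
    and "P \<le> 2 \<Longrightarrow> Q < P - 1"
    and "P > 2 \<Longrightarrow> Q \<le> P - 1"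
    and "d > 1"
    and "\<And>i. i \<in> {1..d} \<Longrightarrow> additive_character (f i)"
    and "\<And>i. i \<in> {1..d} \<Longrightarrow> (\<Prod>j=i..d. norm (f j 1)) \<le> 1"
    and "exp logf = f d 1"
    and "b = - 2 * of_nat k
             + logf / of_real (ln (lucas_alpha P Q))
             + of_nat k * of_real (ln \<bar>Q\<bar>) / of_real (ln (lucas_alpha P Q))
             + of_int (2 * n + int (lucas_ell Q k)) * (of_real pi * \<i>)
                 / of_real (ln (lucas_alpha P Q))"
  shows "has_residue_along d (lucas_L P Q d f) b
           (\<lambda>s. lucas_L P Q (d - 1) f s
                 * complex_of_real (lucas_disc P Q) powr (b / 2)
                 * ((- b) gchoose k) * (- 1) ^ k
                 * (1 / of_real (ln (lucas_alpha P Q))))"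
proof -
  interpret lucas_characters P Q f d
    using assms(1-4,6) by unfold_locales auto
  obtain m where d: "d = Suc m" using assms(5) by (cases d) auto
  let ?l = "complex_of_real (ln \<alpha>)"
  have l: "?l \<noteq> 0" using ln_alpha_pos by simp
  \<comment> \<open>This absorbs the term \<open>- 2 * of_nat k\<close> of \<open>b\<close> into a
    multiple of \<open>ln \<bar>q\<bar>\<close>.\<close>
  have ln_q: "ln \<bar>q\<bar> = ln \<bar>Q\<bar> - 2 * ln \<alpha>"
    using Q_nz alpha_gt_1 by (simp add: q_alt abs_divide ln_div ln_realpow)
  \<comment> \<open>For negative \<open>Q\<close> the ratio \<open>q\<close> is negative, and
    \<open>lucas_ell Q k = k\<close> half-turns supply the sign of \<open>q ^ k\<close>.\<close>
  have q_polar: "complex_of_real q ^ k =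
      exp (of_nat k * of_real (ln \<bar>q\<bar>) + of_nat (lucas_ell Q k) * (of_real pi * \<i>))"
  proof (cases "Q > 0")
    case True
    then have "q > 0" using alpha_gt_1 by (simp add: q_alt)
    then have "complex_of_real q = exp (of_real (ln \<bar>q\<bar>))" by (simp add: exp_of_real)
    then show ?thesis using True by (simp add: lucas_ell_def exp_of_nat_mult)
  next
    case False
    then have "q < 0" using Q_nz alpha_gt_1 by (simp add: q_alt divide_neg_pos)
    then have "complex_of_real q = exp (of_real (ln \<bar>q\<bar>)) * exp (of_real pi * \<i>)"
      by (simp add: exp_of_real)
    then have "complex_of_real q ^ k = exp (of_nat k * of_real (ln \<bar>q\<bar>)) * exp (of_nat k * (of_real pi * \<i>))"
      by (simp only: power_mult_distrib exp_of_nat_mult)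
    then show ?thesis using False by (simp add: lucas_ell_def exp_add)
  qed
  have "b * ?l = logf + of_nat k * of_real (ln \<bar>q\<bar>) + of_int (2 * n + int (lucas_ell Q k)) * (of_real pi * \<i>)"
    using l unfolding assms(9) ln_q by (simp add: field_simps)
  \<comment> \<open>The logarithm of \<open>f d 1\<close>, the modulus of \<open>q ^ k\<close> and
    the half-turns cancel; full turns by \<open>n\<close> remain, so \<open>b\<close> satisfies the
    resonance condition.\<close>
  then have "- b * ?l + logf + (of_nat k * of_real (ln \<bar>q\<bar>) + of_nat (lucas_ell Q k) * (of_real pi * \<i>))
      = - (2 * of_int n * (of_real pi * \<i>))"
    by (simp add: algebra_simps)
  moreover have "exp (- (2 * of_int n * (of_real pi * \<i>))) = (1 :: complex)"
    using exp_integer_2pi[of "of_int (- n)"] by (simp add: mult_ac)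
  ultimately have "exp (- b * ?l + logf + (of_nat k * of_real (ln \<bar>q\<bar>) + of_nat (lucas_ell Q k) * (of_real pi * \<i>))) = 1"
    by (simp only:)
  then have "exp (- b * ?l) * f d 1 * of_real q ^ k = 1"
    unfolding exp_add assms(8) q_polar by (simp only: exp_add)
  then have "weight (Suc m) b * of_real q ^ k = 1"
    by (simp add: weight_def d mult_ac)
  from has_residue_along_lucas_L[OF _ this] d
  have "has_residue_along d (lucas_L P Q d f) b
    (\<lambda>s. lucas_L P Q (d - 1) f s * complex_of_real D powr (b / 2) * coef b k * (1 / ?l))"
    by simp
  moreover have "coef b k = ((- b) gchoose k) * (- 1) ^ k"
    using gbinomial_minus_power[of b k 1] by (simp add: coef_def)
  ultimately show ?thesis by (simp only: mult.assoc)
qed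

end
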